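(* Let $X$ be a reflexive Banach space and $\varphi:X\to\mathbb{R}$ locally Lipschitz continuous satisfying the Cerami condition (C). Let $a\in\mathbb{R}$ and $a<b\le\infty$ be such that $K_a(\varphi)$ is finite and $K_c(\varphi)=\emptyset$ for all $c\in(a,b)$. Then there exists a continuous mapping $h:[0,1]\times(\overline\varphi^b\setminus K_b(\varphi))\to\overline\varphi^b\setminus K_b(\varphi)$ such that (i) $h(0,u)=u$ and $h(1,u)\in\overline\varphi^a$ for all $u\in\overline\varphi^b\setminus K_b(\varphi)$; (ii) $h(t,u)=u$ for all $(t,u)\in[0,1]\times\overline\varphi^a$; (iii) $\varphi(h(t,u))\le\varphi(u)$ for all $(t,u)\in[0,1]\times(\overline\varphi^b\setminus K_b(\varphi))$. In particular, $\overline\varphi^a$ is a strong deformation retract of $\overline\varphi^b\setminus K_b(\varphi)$.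
   Context: For locally Lipschitz $\varphi:X\to\mathbb{R}$: Clarke directional derivative $\varphi^\circ(u;v)=\limsup_{w\to u,\,t\to0^+}\frac{\varphi(w+tv)-\varphi(w)}{t}$; Clarke subdifferential $\partial\varphi(u)=\{u^*\in X^*:\langle u^*,v\rangle\le\varphi^\circ(u;v)\ \forall v\in X\}$ (nonempty, weakly* compact); $m(u)=\min_{u^*\in\partial\varphi(u)}\|u^*\|_*$. $u$ is a critical point if $m(u)=0$; $K(\varphi)$ is the set of critical points and $K_c(\varphi)=\{u\in K(\varphi):\varphi(u)=c\}$ (with $K_\infty(\varphi)=\emptyset$). $\varphi$ satisfies the Cerami condition (C) if every sequence $(u_n)$ with $(\varphi(u_n))$ bounded and $(1+\|u_n\|)m(u_n)\to0$ has a convergent subsequence. Sublevel sets: $\overline\varphi^c=\{u\in X:\varphi(u)\le c\}$, and $\overline\varphi^\infty=X$. *)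

theory Defs
  imports "HOL-Analysis.Analysis"
begin

definition reflexive_space :: "'a::real_normed_vector itself \<Rightarrow> bool" where
  "reflexive_space _ \<longleftrightarrow>
     (\<forall>F :: ('a \<Rightarrow>\<^sub>L real) \<Rightarrow>\<^sub>L real. \<exists>x::'a. \<forall>f. blinfun_apply F f = blinfun_apply f x)"

definition locally_lipschitz :: "('a::real_normed_vector \<Rightarrow> real) \<Rightarrow> bool" where
  "locally_lipschitz \<phi> \<longleftrightarrow>
     (\<forall>u. \<exists>e>0. \<exists>L. \<forall>x\<in>ball u e. \<forall>y\<in>ball u e. \<bar>\<phi> x - \<phi> y\<bar> \<le> L * dist x y)"

definition clarke_dd :: "('a::real_normed_vector \<Rightarrow> real) \<Rightarrow> 'a \<Rightarrow> 'a \<Rightarrow> real" where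
  "clarke_dd \<phi> u v = real_of_ereal
     (Limsup (at (u, 0) within (UNIV \<times> {0<..}))
        (\<lambda>(w, t). ereal ((\<phi> (w + t *\<^sub>R v) - \<phi> w) / t)))"

definition clarke_subdiff :: "('a::real_normed_vector \<Rightarrow> real) \<Rightarrow> 'a \<Rightarrow> ('a \<Rightarrow>\<^sub>L real) set" where
  "clarke_subdiff \<phi> u = {us. \<forall>v. blinfun_apply us v \<le> clarke_dd \<phi> u v}"

text \<open>m(u) = min of the dual norm over the Clarke subdifferential (the minimum is attained).\<close>
definition mnorm :: "('a::real_normed_vector \<Rightarrow> real) \<Rightarrow> 'a \<Rightarrow> real" where
  "mnorm \<phi> u = Inf (norm ` clarke_subdiff \<phi> u)"

definition crit :: "('a::real_normed_vector \<Rightarrow> real) \<Rightarrow> 'a set" where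
  "crit \<phi> = {u. mnorm \<phi> u = 0}"

definition crit_at :: "('a::real_normed_vector \<Rightarrow> real) \<Rightarrow> ereal \<Rightarrow> 'a set" where
  "crit_at \<phi> c = {u \<in> crit \<phi>. ereal (\<phi> u) = c}"

definition sublevel :: "('a \<Rightarrow> real) \<Rightarrow> ereal \<Rightarrow> 'a set" where
  "sublevel \<phi> c = {u. ereal (\<phi> u) \<le> c}"

definition cerami :: "('a::real_normed_vector \<Rightarrow> real) \<Rightarrow> bool" where
  "cerami \<phi> \<longleftrightarrow>
     (\<forall>u :: nat \<Rightarrow> 'a. bounded (range (\<lambda>n. \<phi> (u n))) \<and>
        (\<lambda>n. (1 + norm (u n)) * mnorm \<phi> (u n)) \<longlonglongrightarrow> 0
        \<longrightarrow> (\<exists>r. strict_mono r \<and> convergent (u \<circ> r)))"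

end

theory Submission
  imports Defs
begin

text \<open>
  Off the critical set, Hahn-Banach turns \<open>c < mnorm \<phi> u\<close> into a direction of norm at most 1
  along which \<open>\<phi>\<close> decreases at rate more than \<open>c\<close> near \<open>u\<close>. Admissible directions form
  convex sets, so a continuous selection exists on the open set \<open>{a < \<phi>} - crit \<phi>\<close>, and no
  differential equation is needed: one Euler step \<open>u \<mapsto> u + \<tau> u *\<^sub>R V u\<close> with a continuous
  step size \<open>\<tau> > 0\<close> is a homotopy of this set, and its iterates form polygons along which
  \<open>\<phi>\<close> drops by at least the length weighted with a continuous minorant of the Cerami weight.
  The vertices of a polygon cannot converge to a noncritical point above level \<open>a\<close>, because
  it would be fixed by the Euler step.

  Since \<open>K\<^sub>a\<close> is finite, every point \<open>z\<close> at level \<open>a\<close> is surrounded by annuli free of critical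
  points of level \<open>a\<close>; crossing one costs a fixed amount of \<open>\<phi>\<close>, so polygons that come close
  to \<open>z\<close> stay close to \<open>z\<close>. This stability yields both the convergence of each polygon to a
  point at level \<open>a\<close> and the continuity of the limit in the starting point.
\<close>

section \<open>Sublinear functionals and the Hahn-Banach theorem\<close>

definition sublinear :: "('a::real_vector \<Rightarrow> real) \<Rightarrow> bool" where
  "sublinear p \<longleftrightarrow> (\<forall>x y. p (x + y) \<le> p x + p y) \<and> (\<forall>t\<ge>0. \<forall>x. p (t *\<^sub>R x) = t * p x)"

lemma sublinear_add: "sublinear p \<Longrightarrow> p (x + y) \<le> p x + p y"
  by (simp add: sublinear_def)

lemma sublinear_scaleR: "sublinear p \<Longrightarrow> 0 \<le> t \<Longrightarrow> p (t *\<^sub>R x) = t * p x"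
  by (simp add: sublinear_def)

lemma sublinear_zero: "sublinear p \<Longrightarrow> p 0 = 0"
  using sublinear_scaleR[of p 0 0] by simp

lemma sublinear_minus: "sublinear p \<Longrightarrow> - p (- x) \<le> p x"
  using sublinear_add[of p x "- x"] sublinear_zero[of p] by simp

lemma sublinearI:
  assumes add: "\<And>x y. p (x + y) \<le> p x + p y"
    and scale: "\<And>t x. 0 < t \<Longrightarrow> p (t *\<^sub>R x) \<le> t * p x"
  shows "sublinear p"
proof -
  have zero: "p 0 = 0"
    using scale[of 2 0] scale[of "1 / 2" 0] by simp
  have "p (t *\<^sub>R x) = t * p x" if "0 \<le> t" for t x
  proof (cases "t = 0")
    case False
    with that have "0 < t" by simp
    then have "p x \<le> inverse t * p (t *\<^sub>R x)"
      using scale[of "inverse t" "t *\<^sub>R x"] by simp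
    with \<open>0 < t\<close> scale[of t x] show ?thesis
      by (simp add: field_simps)
  qed (simp add: zero)
  with add show ?thesis
    by (simp add: sublinear_def)
qed

lemma sublinear_INF:
  fixes q :: "'i \<Rightarrow> 'a::real_vector \<Rightarrow> real"
  assumes nonempty: "I \<noteq> {}"
    and bdd: "\<And>x. bdd_below ((\<lambda>i. q i x) ` I)"
    and add: "\<And>i j x y. i \<in> I \<Longrightarrow> j \<in> I \<Longrightarrow> \<exists>k\<in>I. q k (x + y) \<le> q i x + q j y"
    and scale: "\<And>i t x. i \<in> I \<Longrightarrow> 0 < t \<Longrightarrow> \<exists>k\<in>I. q k (t *\<^sub>R x) \<le> t * q i x"
  shows "sublinear (\<lambda>x. INF i\<in>I. q i x)"
proof (rule sublinearI)
  define Q where "Q x = (INF i\<in>I. q i x)" for x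
  have Q_le: "Q x \<le> q i x" if "i \<in> I" for i x
    unfolding Q_def using bdd that by (rule cINF_lower)
  have le_Q: "c \<le> Q x" if "\<And>i. i \<in> I \<Longrightarrow> c \<le> q i x" for c x
    unfolding Q_def using nonempty that by (rule cINF_greatest)
  show "(INF i\<in>I. q i (x + y)) \<le> (INF i\<in>I. q i x) + (INF i\<in>I. q i y)" for x y
  proof -
    have "Q (x + y) - q i x \<le> q j y" if "i \<in> I" "j \<in> I" for i j
      using add[OF that, of x y] Q_le[of _ "x + y"] by force
    then have "Q (x + y) - q i x \<le> Q y" if "i \<in> I" for i
      using that by (intro le_Q)
    then have "Q (x + y) - Q y \<le> Q x"
      by (intro le_Q) fastforce
    then show ?thesis by (simp add: Q_def)
  qed
  show "(INF i\<in>I. q i (t *\<^sub>R x)) \<le> t * (INF i\<in>I. q i x)" if t: "0 < t" for t x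
  proof -
    have "Q (t *\<^sub>R x) / t \<le> Q x"
    proof (rule le_Q)
      fix i assume "i \<in> I"
      then obtain k where "k \<in> I" "q k (t *\<^sub>R x) \<le> t * q i x"
        using scale t by blast
      then have "Q (t *\<^sub>R x) \<le> t * q i x"
        using Q_le[of k "t *\<^sub>R x"] by linarith
      with t show "Q (t *\<^sub>R x) / t \<le> q i x"
        by (simp add: field_simps)
    qed
    with t show ?thesis by (simp add: Q_def field_simps)
  qed
qed

lemma sublinear_superadditive_imp_linear:
  assumes "sublinear q" and super: "\<And>x y. q x + q y \<le> q (x + y)"
  shows "linear q"
proof (rule linearI)
  show add: "q (x + y) = q x + q y" for x y
    using sublinear_add[OF assms(1)] super by (rule antisym)
  have neg: "q (- x) = - q x" for x
    using add[of x "- x"] sublinear_zero[OF assms(1)] by simp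
  show "q (t *\<^sub>R x) = t *\<^sub>R q x" for t x
    using sublinear_scaleR[OF assms(1), of t x] sublinear_scaleR[OF assms(1), of "- t" x]
      neg[of "t *\<^sub>R x"] by (cases "0 \<le> t") auto
qed

text \<open>Replacing a minimal sublinear \<open>q\<close> by \<open>x \<mapsto> inf\<^bsub>t \<ge> 0\<^esub> (q (x + t y) - t q y)\<close>
  cannot make it smaller, whence \<open>q x + q y \<le> q (x + y)\<close>.\<close>

lemma minimal_sublinear_imp_linear:
  assumes q: "sublinear q"
    and minimal: "\<And>q'. sublinear q' \<Longrightarrow> (\<And>x. q' x \<le> q x) \<Longrightarrow> q' = q"
  shows "linear q"
proof (rule sublinear_superadditive_imp_linear[OF q])
  fix x y
  define g where "g t x = q (x + t *\<^sub>R y) - t * q y" for t x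
  have "- q (- x) \<le> g t x" if "0 \<le> t" for t x
    using sublinear_add[OF q, of "x + t *\<^sub>R y" "- x"] sublinear_scaleR[OF q that, of y]
    by (simp add: g_def)
  then have bdd: "bdd_below ((\<lambda>t. g t x) ` {0..})" for x
    by (intro bdd_belowI2[of _ "- q (- x)"]) auto
  have "sublinear (\<lambda>x. INF t\<in>{0..}. g t x)"
  proof (rule sublinear_INF[OF _ bdd])
    fix s t :: real and x x' assume "s \<in> {0..}" "t \<in> {0..}"
    then show "\<exists>r\<in>{0..}. g r (x + x') \<le> g s x + g t x'"
      using sublinear_add[OF q, of "x + s *\<^sub>R y" "x' + t *\<^sub>R y"]
      by (intro bexI[of _ "s + t"]) (auto simp: g_def algebra_simps)
  next
    fix s t :: real and x assume "s \<in> {0..}" "0 < t"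
    then show "\<exists>r\<in>{0..}. g r (t *\<^sub>R x) \<le> t * g s x"
      using sublinear_scaleR[OF q, of t "x + s *\<^sub>R y"]
      by (intro bexI[of _ "t * s"]) (auto simp: g_def algebra_simps)
  qed auto
  moreover have "(INF t\<in>{0..}. g t x) \<le> q x" for x
    using cINF_lower[OF bdd, of 0 x] by (simp add: g_def)
  ultimately have "(\<lambda>x. INF t\<in>{0..}. g t x) = q"
    by (rule minimal)
  then have "q x = (INF t\<in>{0..}. g t x)" by metis
  also have "\<dots> \<le> g 1 x" by (rule cINF_lower[OF bdd]) simp
  finally show "q x + q y \<le> q (x + y)" by (simp add: g_def)
qed

lemma sublinear_chain_lower_bound:
  assumes "C \<noteq> {}" and sub: "\<And>q. q \<in> C \<Longrightarrow> sublinear q" and le: "\<And>q x. q \<in> C \<Longrightarrow> q x \<le> p x"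
    and chain: "\<And>q q'. q \<in> C \<Longrightarrow> q' \<in> C \<Longrightarrow> q \<le> q' \<or> q' \<le> q"
  obtains l where "sublinear l" "\<And>q x. q \<in> C \<Longrightarrow> l x \<le> q x"
proof -
  have bdd: "bdd_below ((\<lambda>q. q x) ` C)" for x
  proof (rule bdd_belowI2)
    fix q assume "q \<in> C"
    then show "- p (- x) \<le> q x"
      using le[of q "- x"] sublinear_minus[OF sub, of q x] by linarith
  qed
  have "sublinear (\<lambda>x. INF q\<in>C. q x)"
  proof (rule sublinear_INF[OF assms(1) bdd])
    fix q q' x y assume "q \<in> C" "q' \<in> C"
    then obtain m where m: "m \<in> C" "m \<le> q" "m \<le> q'"
      using chain by blast
    have "m (x + y) \<le> m x + m y"
      using sub[OF m(1)] by (rule sublinear_add)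
    also have "\<dots> \<le> q x + q' y"
      using m by (intro add_mono) (auto simp: le_fun_def)
    finally show "\<exists>k\<in>C. k (x + y) \<le> q x + q' y"
      using m(1) by blast
  next
    fix q x and t :: real assume "q \<in> C" "0 < t"
    then show "\<exists>k\<in>C. k (t *\<^sub>R x) \<le> t * q x"
      using sublinear_scaleR[OF sub, of q t x] by (intro bexI[of _ q]) auto
  qed
  moreover have "(INF q\<in>C. q x) \<le> q x" if "q \<in> C" for q x
    using bdd that by (rule cINF_lower)
  ultimately show thesis by (rule that)
qed

lemma minimal_sublinear_below_exists:
  fixes p :: "'a::real_vector \<Rightarrow> real"
  assumes p: "sublinear p"
  obtains m where "sublinear m" "m \<le> p" "\<And>q. sublinear q \<Longrightarrow> q \<le> m \<Longrightarrow> q = m"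
proof -
  define A where "A = {q. sublinear q \<and> q \<le> p}"
  define geq where "geq = (\<lambda>q q' :: 'a \<Rightarrow> real. q' \<le> q)"
  have "\<exists>m\<in>A. \<forall>q\<in>A. geq m q \<longrightarrow> q = m"
  proof (rule predicate_Zorn)
    show "partial_order_on A (relation_of geq A)"
      unfolding partial_order_on_def preorder_on_def relation_of_def geq_def
      by (auto simp: refl_on_def trans_def antisym_def)
  next
    fix C assume "C \<in> Chains (relation_of geq A)"
    then have A: "C \<subseteq> A" and chain: "\<And>q q'. q \<in> C \<Longrightarrow> q' \<in> C \<Longrightarrow> q \<le> q' \<or> q' \<le> q"
      unfolding Chains_def relation_of_def geq_def by blast+
    show "\<exists>l\<in>A. \<forall>q\<in>C. geq q l"
    proof (cases "C = {}")
      case False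
      obtain l where l: "sublinear l" "\<And>q x. q \<in> C \<Longrightarrow> l x \<le> q x"
        by (rule sublinear_chain_lower_bound[OF False _ _ chain, of p])
          (use A in \<open>auto simp: A_def le_fun_def\<close>)
      moreover have "l \<le> p"
        using False A l(2) unfolding A_def le_fun_def by (blast intro: order_trans)
      ultimately show ?thesis
        by (auto simp: A_def geq_def le_fun_def)
    qed (use p in \<open>auto simp: A_def\<close>)
  qed
  then obtain m where "m \<in> A" and m: "\<And>q. q \<in> A \<Longrightarrow> q \<le> m \<Longrightarrow> q = m"
    by (auto simp: geq_def)
  show thesis
  proof (rule that)
    show "sublinear m" "m \<le> p"
      using \<open>m \<in> A\<close> by (simp_all add: A_def)
    show "q = m" if "sublinear q" "q \<le> m" for q
      using that \<open>m \<in> A\<close> by (intro m) (auto simp: A_def)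
  qed
qed

theorem hahn_banach_sublinear:
  fixes p :: "'a::real_vector \<Rightarrow> real"
  assumes "sublinear p"
  obtains f where "linear f" "\<And>x. f x \<le> p x"
proof -
  obtain m where "sublinear m" "m \<le> p" and m: "\<And>q. sublinear q \<Longrightarrow> q \<le> m \<Longrightarrow> q = m"
    using minimal_sublinear_below_exists[OF assms] by metis
  have "linear m"
    using \<open>sublinear m\<close> by (rule minimal_sublinear_imp_linear) (simp add: m le_fun_def)
  with \<open>m \<le> p\<close> that show thesis
    by (auto simp: le_fun_def)
qed

definition infimal_convolution :: "('a::real_vector \<Rightarrow> real) \<Rightarrow> ('a \<Rightarrow> real) \<Rightarrow> 'a \<Rightarrow> real" where
  "infimal_convolution p q x = (INF y. p y + q (x - y))"

lemma sublinear_infimal_convolution: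
  assumes p: "sublinear p" and q: "sublinear q"
    and bdd: "\<And>x. bdd_below (range (\<lambda>y. p y + q (x - y)))"
  shows "sublinear (infimal_convolution p q)"
  unfolding infimal_convolution_def
proof (rule sublinear_INF[OF _ bdd])
  fix y y' x x' :: 'a
  show "\<exists>z\<in>UNIV. p z + q (x + x' - z) \<le> p y + q (x - y) + (p y' + q (x' - y'))"
    using sublinear_add[OF p, of y y'] sublinear_add[OF q, of "x - y" "x' - y'"]
    by (intro bexI[of _ "y + y'"]) (auto simp: algebra_simps)
next
  fix y x :: 'a and t :: real assume "0 < t"
  then show "\<exists>z\<in>UNIV. p z + q (t *\<^sub>R x - z) \<le> t * (p y + q (x - y))"
    using sublinear_scaleR[OF p, of t y] sublinear_scaleR[OF q, of t "x - y"]
    by (intro bexI[of _ "t *\<^sub>R y"]) (auto simp: algebra_simps)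
qed simp

lemma infimal_convolution_le:
  assumes "sublinear p" "sublinear q" "\<And>x. bdd_below (range (\<lambda>y. p y + q (x - y)))"
  shows "infimal_convolution p q x \<le> p x" "infimal_convolution p q x \<le> q x"
  using cINF_lower[OF assms(3), of x x] cINF_lower[OF assms(3), of 0 x]
  by (simp_all add: infimal_convolution_def sublinear_zero assms)

lemma linear_le_norm_imp_blinfun:
  fixes f :: "'a::real_normed_vector \<Rightarrow> real"
  assumes f: "linear f" and c: "0 \<le> c" and le: "\<And>v. f v \<le> c * norm v"
  obtains F :: "'a \<Rightarrow>\<^sub>L real" where "blinfun_apply F = f" "norm F \<le> c"
proof -
  have bound: "norm (f v) \<le> c * norm v" for v
    using le[of v] le[of "- v"] linear_neg[OF f, of v] by (simp add: abs_le_iff)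
  have "bounded_linear f"
    by (rule bounded_linear_intro[of _ c])
      (use f bound in \<open>auto simp: linear_add linear_scale mult.commute\<close>)
  then have Blinfun_f: "blinfun_apply (Blinfun f) = f"
    by (rule bounded_linear_Blinfun_apply)
  show thesis
    using Blinfun_f bound c by (intro that[of "Blinfun f"] norm_blinfun_bound) auto
qed

theorem hahn_banach_blinfun:
  fixes p :: "'a::real_normed_vector \<Rightarrow> real"
  assumes p: "sublinear p" and c: "0 \<le> c" and lower: "\<And>v. - (c * norm v) \<le> p v"
  obtains f :: "'a \<Rightarrow>\<^sub>L real" where "\<And>v. blinfun_apply f v \<le> p v" "norm f \<le> c"
proof -
  define q where "q v = c * norm v" for v :: 'a
  have q: "sublinear q"
    using c norm_triangle_ineq
    by (intro sublinearI) (auto simp: q_def intro!: mult_left_mono simp flip: distrib_left)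
  have "- q x \<le> p y + q (x - y)" for x y
    using lower[of y] sublinear_add[OF q, of "x - y" "- x"] by (simp add: q_def)
  then have bdd: "bdd_below (range (\<lambda>y. p y + q (x - y)))" for x
    by (intro bdd_belowI2[of _ "- q x"]) auto
  obtain f where f: "linear f" "\<And>v. f v \<le> infimal_convolution p q v"
    using hahn_banach_sublinear[OF sublinear_infimal_convolution[OF p q bdd]] by metis
  have f_le: "f v \<le> p v" "f v \<le> c * norm v" for v
    using f(2)[of v] infimal_convolution_le[OF p q bdd, of v] unfolding q_def by linarith+
  obtain F :: "'a \<Rightarrow>\<^sub>L real" where "blinfun_apply F = f" "norm F \<le> c"
    using linear_le_norm_imp_blinfun[OF f(1) c f_le(2)] by metis
  with f_le(1) that show thesis by metis
qed

section \<open>The Clarke directional derivative\<close>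

lemma locally_lipschitz_ball:
  assumes "locally_lipschitz \<phi>"
  obtains e L where "0 < e" "L-lipschitz_on (ball u e) \<phi>"
proof -
  obtain e L where "0 < e" and L: "\<forall>x\<in>ball u e. \<forall>y\<in>ball u e. \<bar>\<phi> x - \<phi> y\<bar> \<le> L * dist x y"
    using assms unfolding locally_lipschitz_def by blast
  have "\<bar>L\<bar>-lipschitz_on (ball u e) \<phi>"
  proof (rule lipschitz_onI)
    fix x y assume "x \<in> ball u e" "y \<in> ball u e"
    then have "dist (\<phi> x) (\<phi> y) \<le> L * dist x y"
      using L by (simp add: dist_real_def)
    also have "\<dots> \<le> \<bar>L\<bar> * dist x y"
      by (intro mult_right_mono) auto
    finally show "dist (\<phi> x) (\<phi> y) \<le> \<bar>L\<bar> * dist x y" .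
  qed simp
  with \<open>0 < e\<close> show thesis
    by (rule that)
qed

lemma locally_lipschitz_isCont:
  assumes "locally_lipschitz \<phi>"
  shows "isCont \<phi> u"
proof -
  obtain e L where "0 < e" "L-lipschitz_on (ball u e) \<phi>"
    using locally_lipschitz_ball[OF assms] by metis
  then show ?thesis
    using lipschitz_on_continuous_on continuous_on_eq_continuous_at[of "ball u e" \<phi>] by auto
qed

lemma open_superlevel:
  assumes "locally_lipschitz \<phi>"
  shows "open {u. a < \<phi> u}"
  using locally_lipschitz_isCont[OF assms]
  by (intro open_Collect_less continuous_on_const continuous_at_imp_continuous_on) auto

lemma eventually_nhds_isCont:
  assumes "\<forall>\<^sub>F y in nhds b. P y" "isCont f a" "f a = b"
  shows "\<forall>\<^sub>F x in nhds a. P (f x)"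
  using eventually_compose_filterlim[OF assms(1), of f "nhds a"] assms(2,3)
    tendsto_at_iff_tendsto_nhds[of f a] by (simp add: isCont_def)

lemma eventually_clarke_filter_iff:
  "(\<forall>\<^sub>F x in at (u, 0::real) within (UNIV \<times> {0<..}). P x) \<longleftrightarrow>
    (\<forall>\<^sub>F (w, t) in nhds (u, 0). 0 < t \<longrightarrow> P (w, t))"
  unfolding eventually_at_filter
  by (intro eventually_cong always_eventually allI) (auto simp: mem_Times_iff)

lemma clarke_filter_neq_bot:
  "at (u::'a::real_normed_vector, 0::real) within (UNIV \<times> {0<..}) \<noteq> bot"
proof
  assume "at (u, 0::real) within (UNIV \<times> {0<..}) = bot"
  then have "\<forall>\<^sub>F (w, t) in nhds (u, 0::real). \<not> 0 < t"
    using eventually_clarke_filter_iff[of "\<lambda>_. False" u] by simp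
  then have "\<forall>\<^sub>F t in nhds 0. \<not> 0 < (t::real)"
    using eventually_nhds_isCont[where f = "Pair u" and a = 0] by (force intro: continuous_intros)
  then have "\<forall>\<^sub>F t in at_right (0::real). False"
    unfolding eventually_at_filter by (rule eventually_mono) simp
  then show False
    using trivial_limit_at_right_real[of "0::real"] by (simp add: eventually_False)
qed

lemma eventually_increment_le:
  assumes "0 < e" "L-lipschitz_on (ball u e) \<phi>"
  shows "\<forall>\<^sub>F (w, t) in nhds (u, 0). 0 < t \<longrightarrow> \<bar>\<phi> (w + t *\<^sub>R v) - \<phi> w\<bar> \<le> L * norm v * t"
proof -
  have ball: "\<forall>\<^sub>F w in nhds u. w \<in> ball u e"
    using assms(1) by (intro eventually_nhds_in_open) auto
  have "\<forall>\<^sub>F x in nhds (u, 0). fst x + snd x *\<^sub>R v \<in> ball u e"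
    by (intro eventually_nhds_isCont[OF ball] continuous_intros) simp
  moreover have "\<forall>\<^sub>F x in nhds (u, 0::real). fst x \<in> ball u e"
    by (intro eventually_nhds_isCont[OF ball] continuous_intros) simp
  ultimately show ?thesis
  proof eventually_elim
    case (elim x)
    then show ?case
      using lipschitz_onD[OF assms(2), of "fst x + snd x *\<^sub>R v" "fst x"]
      by (auto simp: dist_norm mult_ac split: prod.split)
  qed
qed

text \<open>The quotients are bounded near \<open>(u, 0)\<close>, so the \<open>Limsup\<close> is finite and
  \<open>real_of_ereal\<close> does not return a junk value.\<close>

lemma ereal_clarke_dd:
  assumes "locally_lipschitz \<phi>"
  shows "ereal (clarke_dd \<phi> u v) = Limsup (at (u, 0) within (UNIV \<times> {0<..}))
    (\<lambda>(w, t). ereal ((\<phi> (w + t *\<^sub>R v) - \<phi> w) / t))"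
proof -
  let ?F = "at (u, 0::real) within (UNIV \<times> {0<..})"
  let ?q = "\<lambda>(w, t). ereal ((\<phi> (w + t *\<^sub>R v) - \<phi> w) / t)"
  obtain e L where "0 < e" "L-lipschitz_on (ball u e) \<phi>"
    using locally_lipschitz_ball[OF assms] by metis
  then have "\<forall>\<^sub>F (w, t) in nhds (u, 0). 0 < t \<longrightarrow> \<bar>\<phi> (w + t *\<^sub>R v) - \<phi> w\<bar> \<le> L * norm v * t"
    by (rule eventually_increment_le)
  then have "\<forall>\<^sub>F x in ?F. ?q x \<le> ereal (L * norm v)" "\<forall>\<^sub>F x in ?F. - ereal (L * norm v) \<le> ?q x"
    unfolding eventually_clarke_filter_iff
    by (rule eventually_mono; auto simp: field_simps abs_le_iff)+
  then have "Limsup ?F ?q \<le> ereal (L * norm v)" "- ereal (L * norm v) \<le> Liminf ?F ?q"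
    by (auto intro: Limsup_bounded Liminf_bounded)
  moreover have "Liminf ?F ?q \<le> Limsup ?F ?q"
    by (rule Liminf_le_Limsup[OF clarke_filter_neq_bot])
  ultimately have "\<bar>Limsup ?F ?q\<bar> \<noteq> \<infinity>"
    by auto
  then show ?thesis
    by (simp add: clarke_dd_def ereal_real)
qed

lemma clarke_dd_lessD:
  assumes "locally_lipschitz \<phi>" "clarke_dd \<phi> u v < k"
  shows "\<forall>\<^sub>F (w, t) in nhds (u, 0). 0 < t \<longrightarrow> \<phi> (w + t *\<^sub>R v) - \<phi> w < k * t"
proof -
  have "\<forall>\<^sub>F x in at (u, 0) within (UNIV \<times> {0<..}).
      (case x of (w, t) \<Rightarrow> ereal ((\<phi> (w + t *\<^sub>R v) - \<phi> w) / t)) < ereal k"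
    using assms by (intro Limsup_lessD) (simp flip: ereal_clarke_dd)
  then show ?thesis
    unfolding eventually_clarke_filter_iff
    by (rule eventually_mono) (auto simp: divide_less_eq)
qed

lemma clarke_dd_leI:
  assumes "locally_lipschitz \<phi>"
    and "\<forall>\<^sub>F (w, t) in nhds (u, 0). 0 < t \<longrightarrow> \<phi> (w + t *\<^sub>R v) - \<phi> w \<le> k * t"
  shows "clarke_dd \<phi> u v \<le> k"
proof -
  have "\<forall>\<^sub>F x in at (u, 0) within (UNIV \<times> {0<..}).
      (case x of (w, t) \<Rightarrow> ereal ((\<phi> (w + t *\<^sub>R v) - \<phi> w) / t)) \<le> ereal k"
    unfolding eventually_clarke_filter_iff
    by (rule eventually_mono[OF assms(2)]) (auto simp: divide_le_eq)
  then have "ereal (clarke_dd \<phi> u v) \<le> ereal k"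
    unfolding ereal_clarke_dd[OF assms(1)] by (rule Limsup_bounded)
  then show ?thesis by simp
qed

lemma sublinear_clarke_dd:
  assumes lip: "locally_lipschitz \<phi>"
  shows "sublinear (clarke_dd \<phi> u)"
proof (rule sublinearI)
  fix v v'
  show "clarke_dd \<phi> u (v + v') \<le> clarke_dd \<phi> u v + clarke_dd \<phi> u v'"
  proof (rule field_le_epsilon)
    fix e :: real assume "0 < e"
    define k k' where "k = clarke_dd \<phi> u v + e / 2" and "k' = clarke_dd \<phi> u v' + e / 2"
    then have less: "clarke_dd \<phi> u v < k" "clarke_dd \<phi> u v' < k'"
      using \<open>0 < e\<close> by simp_all
    have "\<forall>\<^sub>F x in nhds (u, 0). case (fst x + snd x *\<^sub>R v, snd x) of (w, t) \<Rightarrow>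
        0 < t \<longrightarrow> \<phi> (w + t *\<^sub>R v') - \<phi> w < k' * t"
      by (intro eventually_nhds_isCont[OF clarke_dd_lessD[OF lip less(2)]] continuous_intros) simp
    with clarke_dd_lessD[OF lip less(1)]
    have "\<forall>\<^sub>F (w, t) in nhds (u, 0). 0 < t \<longrightarrow> \<phi> (w + t *\<^sub>R (v + v')) - \<phi> w \<le> (k + k') * t"
      by eventually_elim (auto simp: algebra_simps)
    then have "clarke_dd \<phi> u (v + v') \<le> k + k'"
      by (rule clarke_dd_leI[OF lip])
    then show "clarke_dd \<phi> u (v + v') \<le> clarke_dd \<phi> u v + clarke_dd \<phi> u v' + e"
      by (simp add: k_def k'_def)
  qed
next
  fix s :: real and v assume "0 < s"
  show "clarke_dd \<phi> u (s *\<^sub>R v) \<le> s * clarke_dd \<phi> u v"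
  proof (rule field_le_epsilon)
    fix e :: real assume "0 < e"
    define k where "k = clarke_dd \<phi> u v + e / s"
    then have less: "clarke_dd \<phi> u v < k"
      using \<open>0 < e\<close> \<open>0 < s\<close> by simp
    have "\<forall>\<^sub>F x in nhds (u, 0). case (fst x, snd x * s) of (w, t) \<Rightarrow>
        0 < t \<longrightarrow> \<phi> (w + t *\<^sub>R v) - \<phi> w < k * t"
      by (intro eventually_nhds_isCont[OF clarke_dd_lessD[OF lip less]] continuous_intros) simp
    then have "\<forall>\<^sub>F (w, t) in nhds (u, 0). 0 < t \<longrightarrow> \<phi> (w + t *\<^sub>R s *\<^sub>R v) - \<phi> w \<le> k * s * t"
      by eventually_elim (use \<open>0 < s\<close> in \<open>auto simp: mult_ac\<close>)
    then have "clarke_dd \<phi> u (s *\<^sub>R v) \<le> k * s"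
      by (rule clarke_dd_leI[OF lip])
    then show "clarke_dd \<phi> u (s *\<^sub>R v) \<le> s * clarke_dd \<phi> u v + e"
      using \<open>0 < s\<close> by (simp add: k_def algebra_simps)
  qed
qed

lemma eventually_increment_less:
  assumes lip: "locally_lipschitz \<phi>" and less: "clarke_dd \<phi> u v < k"
  shows "\<forall>\<^sub>F (w, v', t) in nhds (u, v, 0). 0 < t \<longrightarrow> \<phi> (w + t *\<^sub>R v') - \<phi> w < k * t"
proof -
  obtain k' where k': "clarke_dd \<phi> u v < k'" "k' < k"
    using less dense by blast
  obtain e L where e: "0 < e" and L: "L-lipschitz_on (ball u e) \<phi>"
    using locally_lipschitz_ball[OF lip] by metis
  have ball: "\<forall>\<^sub>F w in nhds u. w \<in> ball u e"
    using e by (intro eventually_nhds_in_open) auto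
  have small: "\<forall>\<^sub>F r in nhds 0. r < k - k'"
    using k'(2) eventually_nhds_in_open[of "{..<k - k'}" 0] by simp
  have "\<forall>\<^sub>F x in nhds (u, v, 0). case (fst x, snd (snd x)) of (w, t) \<Rightarrow>
      0 < t \<longrightarrow> \<phi> (w + t *\<^sub>R v) - \<phi> w < k' * t"
    by (intro eventually_nhds_isCont[OF clarke_dd_lessD[OF lip k'(1)]] continuous_intros) simp
  moreover have "\<forall>\<^sub>F x in nhds (u, v, 0). fst x + snd (snd x) *\<^sub>R v \<in> ball u e"
    by (intro eventually_nhds_isCont[OF ball] continuous_intros) simp
  moreover have "\<forall>\<^sub>F x in nhds (u, v, 0). fst x + snd (snd x) *\<^sub>R fst (snd x) \<in> ball u e"
    by (intro eventually_nhds_isCont[OF ball] continuous_intros) simp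
  moreover have "\<forall>\<^sub>F x in nhds (u, v, 0::real). L * norm (fst (snd x) - v) < k - k'"
    by (intro eventually_nhds_isCont[OF small] continuous_intros) simp
  ultimately show ?thesis
  proof eventually_elim
    case (elim x)
    obtain w v' t where x: "x = (w, v', t)"
      by (rule prod_cases3)
    have "\<phi> (w + t *\<^sub>R v') - \<phi> w < k * t" if "0 < t"
    proof -
      have "\<phi> (w + t *\<^sub>R v') - \<phi> (w + t *\<^sub>R v) \<le> L * dist (w + t *\<^sub>R v') (w + t *\<^sub>R v)"
        using lipschitz_onD[OF L, of "w + t *\<^sub>R v'" "w + t *\<^sub>R v"] elim(2,3)
        by (simp add: x dist_real_def abs_le_iff)
      also have "dist (w + t *\<^sub>R v') (w + t *\<^sub>R v) = t * norm (v' - v)"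
        using that by (simp add: dist_norm flip: scaleR_diff_right)
      also have "L * (t * norm (v' - v)) < t * (k - k')"
        using elim(4) that by (simp add: x mult.left_commute)
      finally show ?thesis
        using elim(1) that by (simp add: x algebra_simps)
    qed
    then show ?case by (simp add: x)
  qed
qed

lemma clarke_dd_upper_semicontinuous:
  assumes lip: "locally_lipschitz \<phi>" and less: "clarke_dd \<phi> u v < k"
  shows "\<forall>\<^sub>F w in nhds u. clarke_dd \<phi> w v < k"
proof -
  obtain k' where k': "clarke_dd \<phi> u v < k'" "k' < k"
    using less dense by blast
  have "\<forall>\<^sub>F x in nhds (u, 0). \<forall>\<^sub>F (w, t) in nhds x. 0 < t \<longrightarrow> \<phi> (w + t *\<^sub>R v) - \<phi> w < k' * t"
    unfolding eventually_eventually by (rule clarke_dd_lessD[OF lip k'(1)])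
  then have "\<forall>\<^sub>F y in nhds u. \<forall>\<^sub>F (w, t) in nhds (y, 0). 0 < t \<longrightarrow> \<phi> (w + t *\<^sub>R v) - \<phi> w < k' * t"
    by (rule eventually_nhds_isCont) (intro continuous_intros refl)+
  then show ?thesis
  proof eventually_elim
    case (elim y)
    then have "clarke_dd \<phi> y v \<le> k'"
      by (intro clarke_dd_leI[OF lip]) (auto elim!: eventually_mono)
    with k'(2) show ?case by simp
  qed
qed

section \<open>The minimal norm of the Clarke subdifferential\<close>

lemma clarke_dd_lower_bound:
  assumes lip: "locally_lipschitz \<phi>"
  obtains L where "0 \<le> L" "\<And>v. - (L * norm v) \<le> clarke_dd \<phi> u v"
proof -
  obtain e L where L: "0 < e" "L-lipschitz_on (ball u e) \<phi>"
    using locally_lipschitz_ball[OF lip] by metis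
  have upper: "clarke_dd \<phi> u v \<le> L * norm v" for v
    by (intro clarke_dd_leI[OF lip] eventually_mono[OF eventually_increment_le[OF L, of v]]) auto
  have "- (L * norm v) \<le> clarke_dd \<phi> u v" for v
    using sublinear_minus[OF sublinear_clarke_dd[OF lip], of u v] upper[of "- v"] by simp
  with lipschitz_on_nonneg[OF L(2)] show thesis
    by (rule that)
qed

lemma clarke_subdiff_nonempty:
  assumes "locally_lipschitz \<phi>"
  shows "clarke_subdiff \<phi> u \<noteq> {}"
proof -
  obtain L where "0 \<le> L" "\<And>v. - (L * norm v) \<le> clarke_dd \<phi> u v"
    using clarke_dd_lower_bound[OF assms] by metis
  then show ?thesis
    using hahn_banach_blinfun[OF sublinear_clarke_dd[OF assms]]
    unfolding clarke_subdiff_def by blast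
qed

lemma mnorm_nonneg:
  assumes "locally_lipschitz \<phi>"
  shows "0 \<le> mnorm \<phi> u"
  unfolding mnorm_def by (rule cINF_greatest[OF clarke_subdiff_nonempty[OF assms]]) simp

lemma mnorm_leI:
  assumes lip: "locally_lipschitz \<phi>" and "0 \<le> c" "\<And>v. - (c * norm v) \<le> clarke_dd \<phi> u v"
  shows "mnorm \<phi> u \<le> c"
proof -
  obtain f where f: "\<And>v. blinfun_apply f v \<le> clarke_dd \<phi> u v" "norm f \<le> c"
    using hahn_banach_blinfun[OF sublinear_clarke_dd[OF lip] assms(2,3)] by metis
  have "mnorm \<phi> u \<le> norm f"
    unfolding mnorm_def using f(1)
    by (intro cInf_lower bdd_belowI[of _ 0]) (auto simp: clarke_subdiff_def)
  with f(2) show ?thesis by simp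
qed

lemma mnorm_geI:
  assumes lip: "locally_lipschitz \<phi>" and "clarke_dd \<phi> u v \<le> - c" "0 \<le> c" "norm v \<le> 1"
  shows "c \<le> mnorm \<phi> u"
  unfolding mnorm_def
proof (rule cINF_greatest[OF clarke_subdiff_nonempty[OF lip]])
  fix f assume "f \<in> clarke_subdiff \<phi> u"
  then have "c \<le> - blinfun_apply f v"
    using assms(2) order_trans unfolding clarke_subdiff_def by fastforce
  also have "\<dots> \<le> norm f * norm v"
    using norm_blinfun[of f v] by (simp add: abs_le_iff)
  also have "\<dots> \<le> norm f"
    using assms(4) by (simp add: mult_left_le)
  finally show "c \<le> norm f" .
qed

lemma descent_direction:
  assumes lip: "locally_lipschitz \<phi>" and "0 \<le> c" "c < mnorm \<phi> u"
  obtains v where "norm v \<le> 1" "clarke_dd \<phi> u v < - c"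
proof -
  note sublin = sublinear_clarke_dd[OF lip, of u]
  obtain v where v: "clarke_dd \<phi> u v < - (c * norm v)"
    using mnorm_leI[OF lip assms(2), of u] assms(3) by (meson not_less)
  then have "v \<noteq> 0"
    using sublinear_zero[OF sublin] by auto
  have "clarke_dd \<phi> u ((1 / norm v) *\<^sub>R v) = clarke_dd \<phi> u v / norm v"
    by (simp add: sublinear_scaleR[OF sublin])
  also have "\<dots> < - c"
    using v \<open>v \<noteq> 0\<close> by (simp add: field_simps)
  finally show thesis
    using \<open>v \<noteq> 0\<close> by (intro that[of "(1 / norm v) *\<^sub>R v"]) auto
qed

lemma mnorm_lower_semicontinuous:
  assumes lip: "locally_lipschitz \<phi>" and less: "c < mnorm \<phi> u"
  shows "\<forall>\<^sub>F w in nhds u. c < mnorm \<phi> w"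
proof (cases "c < 0")
  case True
  then show ?thesis
    by (intro always_eventually allI less_le_trans[OF _ mnorm_nonneg[OF lip]])
next
  case False
  obtain d where d: "c < d" "d < mnorm \<phi> u"
    using less dense by blast
  obtain v where v: "norm v \<le> 1" "clarke_dd \<phi> u v < - d"
    using descent_direction[OF lip _ d(2)] d(1) False by force
  from clarke_dd_upper_semicontinuous[OF lip v(2)] show ?thesis
  proof eventually_elim
    case (elim w)
    then have "d \<le> mnorm \<phi> w"
      using v(1) d(1) False by (intro mnorm_geI[OF lip]) auto
    with d(1) show ?case by simp
  qed
qed

lemma mem_crit_iff:
  assumes "locally_lipschitz \<phi>"
  shows "u \<in> crit \<phi> \<longleftrightarrow> mnorm \<phi> u \<le> 0"
  using mnorm_nonneg[OF assms, of u] by (auto simp: crit_def)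

lemma closed_crit:
  assumes lip: "locally_lipschitz \<phi>"
  shows "closed (crit \<phi>)"
proof -
  have "\<exists>T. open T \<and> u \<in> T \<and> T \<subseteq> - crit \<phi>" if "u \<in> - crit \<phi>" for u
  proof -
    have "\<forall>\<^sub>F w in nhds u. 0 < mnorm \<phi> w"
      using that by (intro mnorm_lower_semicontinuous[OF lip]) (simp add: mem_crit_iff[OF lip])
    then obtain T where "open T" "u \<in> T" "\<forall>w\<in>T. 0 < mnorm \<phi> w"
      unfolding eventually_nhds by blast
    then show ?thesis
      by (intro exI[of _ T]) (force simp: mem_crit_iff[OF lip])
  qed
  then show ?thesis
    unfolding closed_def by (subst open_subopen) blast
qed

lemma mem_crit_of_mnorm_tendsto_0:
  assumes lip: "locally_lipschitz \<phi>"
    and "y \<longlonglongrightarrow> u" and m0: "(\<lambda>n. mnorm \<phi> (y n)) \<longlonglongrightarrow> 0"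
  shows "u \<in> crit \<phi>"
proof (rule ccontr)
  assume "u \<notin> crit \<phi>"
  then have "0 < mnorm \<phi> u"
    by (simp add: mem_crit_iff[OF lip])
  then obtain c where "0 < c" "c < mnorm \<phi> u"
    using dense by blast
  then have "\<forall>\<^sub>F n in sequentially. c < mnorm \<phi> (y n)"
    using eventually_compose_filterlim[OF mnorm_lower_semicontinuous[OF lip] assms(2)] by simp
  moreover have "\<forall>\<^sub>F n in sequentially. mnorm \<phi> (y n) < c"
    using m0 \<open>0 < c\<close> by (rule order_tendstoD)
  ultimately have "\<forall>\<^sub>F n::nat in sequentially. False"
    by eventually_elim simp
  then show False by simp
qed

section \<open>Continuous selections of convex-valued maps\<close>

text \<open>The heart of Stone's paracompactness theorem: points whose first cover element \<open>U (f x)\<close>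
  contains \<open>ball x r\<close> split into pieces at mutual distance at least \<open>r\<close>.\<close>

lemma least_index_cover:
  fixes U :: "'i \<Rightarrow> 'a::metric_space set"
  assumes cover: "W \<subseteq> (\<Union>i. U i)"
  obtains f where "\<And>x. x \<in> W \<Longrightarrow> x \<in> U (f x)"
    and "\<And>x y r. \<lbrakk>x \<in> W; y \<in> W; ball x r \<subseteq> U (f x); ball y r \<subseteq> U (f y); dist x y < r\<rbrakk> \<Longrightarrow> f x = f y"
proof -
  obtain R :: "('i \<times> 'i) set" where "Well_order R" "Field R = UNIV"
    using well_ordering by metis
  then have wf: "wf (R - Id)" and total: "\<And>i j. i \<noteq> j \<Longrightarrow> (i, j) \<in> R - Id \<or> (j, i) \<in> R - Id"
    unfolding well_order_on_def linear_order_on_def total_on_def by auto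
  have "\<exists>i. x \<in> U i \<and> (\<forall>j. (j, i) \<in> R - Id \<longrightarrow> x \<notin> U j)" if "x \<in> W" for x
    using cover that wfE_min[OF wf, of _ "{i. x \<in> U i}"] by (metis UN_E mem_Collect_eq subsetD)
  then obtain f where f: "\<And>x. x \<in> W \<Longrightarrow> x \<in> U (f x)"
    and least: "\<And>x j. x \<in> W \<Longrightarrow> (j, f x) \<in> R - Id \<Longrightarrow> x \<notin> U j"
    by metis
  show thesis
  proof (rule that[OF f])
    fix x y r
    assume "x \<in> W" "y \<in> W" "ball x r \<subseteq> U (f x)" "ball y r \<subseteq> U (f y)" "dist x y < r"
    then have "x \<in> U (f y)" "y \<in> U (f x)"
      by (auto simp: dist_commute)
    then show "f x = f y"
      using total least \<open>x \<in> W\<close> \<open>y \<in> W\<close> by blast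
  qed
qed

definition bump :: "real \<Rightarrow> 'a::metric_space set \<Rightarrow> 'a \<Rightarrow> real" where
  "bump \<rho> E w = (if E = {} then 0 else max 0 (\<rho> - infdist w E))"

definition nearby_value :: "real \<Rightarrow> 'a::metric_space set \<Rightarrow> ('a \<Rightarrow> 'b) \<Rightarrow> 'a \<Rightarrow> 'b" where
  "nearby_value \<rho> E f w = f (SOME x. x \<in> E \<and> dist w x < \<rho>)"

lemma continuous_on_bump: "continuous_on A (bump \<rho> E)"
  unfolding bump_def by (cases "E = {}") (auto intro!: continuous_intros)

lemma bump_nonneg: "0 \<le> bump \<rho> E w"
  by (simp add: bump_def)

lemma bump_le: "0 \<le> \<rho> \<Longrightarrow> bump \<rho> E w \<le> \<rho>"
  using infdist_nonneg[of w E] by (simp add: bump_def)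

lemma bump_pos: "0 < \<rho> \<Longrightarrow> x \<in> E \<Longrightarrow> 0 < bump \<rho> E x"
  by (auto simp: bump_def)

lemma nearby_valueE:
  assumes "0 < bump \<rho> E w"
  obtains x where "x \<in> E" "dist w x < \<rho>" "nearby_value \<rho> E f w = f x"
proof -
  have "E \<noteq> {}" "infdist w E < \<rho>"
    using assms by (auto simp: bump_def split: if_splits)
  then have "\<exists>x. x \<in> E \<and> dist w x < \<rho>"
    using cINF_less_iff[of E "dist w" \<rho>] by (auto simp: infdist_def)
  from someI_ex[OF this] that show thesis
    by (auto simp: nearby_value_def)
qed

lemma nearby_value_locally_constant:
  assumes "0 < \<rho>" and separated: "\<And>x y. \<lbrakk>x \<in> E; y \<in> E; dist x y < 3 * \<rho>\<rbrakk> \<Longrightarrow> f x = f y"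
  shows "\<exists>v. \<forall>\<^sub>F w in nhds u. 0 < bump \<rho> E w \<longrightarrow> nearby_value \<rho> E f w = v"
proof -
  have const: "nearby_value \<rho> E f w = nearby_value \<rho> E f w'"
    if w: "w \<in> ball u (\<rho> / 2)" "0 < bump \<rho> E w"
      and w': "w' \<in> ball u (\<rho> / 2)" "0 < bump \<rho> E w'" for w w'
  proof -
    obtain x where x: "x \<in> E" "dist w x < \<rho>" "nearby_value \<rho> E f w = f x"
      using nearby_valueE[OF w(2)] .
    obtain y where y: "y \<in> E" "dist w' y < \<rho>" "nearby_value \<rho> E f w' = f y"
      using nearby_valueE[OF w'(2)] .
    have "dist x y \<le> dist w x + (dist u w + dist u w') + dist w' y"
      using dist_triangle[of x y w] dist_triangle[of w y w'] dist_triangle[of w w' u]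
      by (simp add: dist_commute)
    then have "dist x y < 3 * \<rho>"
      using w(1) w'(1) x(2) y(2) by simp
    then show ?thesis
      using separated x y by simp
  qed
  have "\<forall>\<^sub>F w in nhds u. w \<in> ball u (\<rho> / 2)"
    using \<open>0 < \<rho>\<close> by (intro eventually_nhds_in_open) auto
  with const show ?thesis
    by (cases "\<exists>w'\<in>ball u (\<rho> / 2). 0 < bump \<rho> E w'") (blast intro: eventually_mono)+
qed

definition dyadic_mean :: "(nat \<Rightarrow> real) \<Rightarrow> real" where
  "dyadic_mean x = (\<Sum>n. (1 / 2) ^ (n + 2) * x n)"

lemma dyadic_weights_sums: "(\<lambda>n. (1 / 2 :: real) ^ (n + 2)) sums (1 / 2)"
  using sums_mult2[OF geometric_sums[of "1 / 2 :: real"], of "1 / 4"]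
  by (simp add: power_add power2_eq_square)

lemma summable_dyadic_weights: "summable (\<lambda>n. (1 / 2 :: real) ^ (n + 2))"
  using dyadic_weights_sums by (rule sums_summable)

lemma dyadic_term_le:
  fixes r :: real
  assumes "0 \<le> r" "r \<le> 1"
  shows "norm ((1 / 2) ^ (n + 2) * r) \<le> (1 / 2) ^ (n + 2)"
  using assms by (simp add: abs_mult mult_left_le)

lemma summable_dyadic_mean:
  fixes x :: "nat \<Rightarrow> real"
  assumes "\<And>n. 0 \<le> x n" "\<And>n. x n \<le> 1"
  shows "summable (\<lambda>n. (1 / 2) ^ (n + 2) * x n)"
  using summable_dyadic_weights dyadic_term_le[OF assms]
  by (rule summable_comparison_test'[where N = 0])

lemma dyadic_mean_nonneg:
  assumes "\<And>n. 0 \<le> x n" "\<And>n. x n \<le> 1"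
  shows "0 \<le> dyadic_mean x"
  unfolding dyadic_mean_def using assms by (intro suminf_nonneg summable_dyadic_mean) simp_all

lemma dyadic_mean_pos:
  assumes "\<And>n. 0 \<le> x n" "\<And>n. x n \<le> 1" "0 < x n"
  shows "0 < dyadic_mean x"
  unfolding dyadic_mean_def using assms
  by (intro suminf_pos2[OF summable_dyadic_mean, of _ n]) simp_all

lemma dyadic_mean_less:
  assumes "\<And>n. 0 \<le> x n" "\<And>n. x n \<le> 1" "0 < x n"
  shows "\<exists>m. dyadic_mean x < x m"
proof (rule ccontr)
  assume "\<nexists>m. dyadic_mean x < x m"
  then have "dyadic_mean x \<le> (\<Sum>n. (1 / 2) ^ (n + 2) * dyadic_mean x)"
    unfolding dyadic_mean_def[of x]
    by (intro suminf_le summable_dyadic_mean summable_mult2 summable_dyadic_weights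
        mult_left_mono assms(1,2)) (simp_all add: not_less flip: dyadic_mean_def)
  also have "\<dots> = dyadic_mean x / 2"
    using sums_mult2[OF dyadic_weights_sums, of "dyadic_mean x"] by (simp add: sums_iff)
  finally show False
    using dyadic_mean_pos[of x n, OF assms] by simp
qed

lemma continuous_on_dyadic_mean:
  assumes "\<And>n. continuous_on A (g n)" "\<And>n w. 0 \<le> g n w" "\<And>n w. g n w \<le> 1"
  shows "continuous_on A (\<lambda>w. dyadic_mean (\<lambda>n. g n w))"
proof (rule uniform_limit_theorem)
  show "uniform_limit A (\<lambda>N w. \<Sum>n<N. (1 / 2) ^ (n + 2) * g n w)
      (\<lambda>w. dyadic_mean (\<lambda>n. g n w)) sequentially"
    unfolding dyadic_mean_def
    by (rule Weierstrass_m_test[OF dyadic_term_le summable_dyadic_weights]) (rule assms)+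
  show "\<forall>\<^sub>F N in sequentially. continuous_on A (\<lambda>w. \<Sum>n<N. (1 / 2) ^ (n + 2) * g n w)"
    by (intro always_eventually allI continuous_intros assms(1))
qed simp

text \<open>Subtracting the dyadic mean makes the family locally finite because \<open>g n\<close> tends to \<open>0\<close>
  uniformly, and keeps a positive member because the mean is less than some \<open>g m\<close>.\<close>

lemma locally_finite_bumps:
  fixes g :: "nat \<Rightarrow> 'a::topological_space \<Rightarrow> real"
  assumes cont: "\<And>n. continuous_on UNIV (g n)" and nonneg: "\<And>n w. 0 \<le> g n w"
    and le: "\<And>n w. g n w \<le> (1 / 2) ^ n"
  obtains h :: "nat \<Rightarrow> 'a \<Rightarrow> real"
  where "\<And>n. continuous_on UNIV (h n)" "\<And>n w. 0 \<le> h n w"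
    and "\<And>n w. 0 < h n w \<Longrightarrow> 0 < g n w"
    and "\<And>n u. 0 < g n u \<Longrightarrow> \<exists>m. 0 < h m u"
    and "\<And>n u. 0 < g n u \<Longrightarrow> \<exists>N. \<forall>\<^sub>F w in nhds u. \<forall>m\<ge>N. h m w = 0"
proof -
  have le_1: "g n w \<le> 1" for n w
    using le[of n w] power_le_one[of "1 / 2 :: real" n] by simp
  define c where "c w = dyadic_mean (\<lambda>n. g n w)" for w
  have c_cont: "continuous_on UNIV c"
    unfolding c_def by (intro continuous_on_dyadic_mean cont nonneg le_1)
  show thesis
  proof (rule that[of "\<lambda>n w. max 0 (g n w - c w)"])
    show "continuous_on UNIV (\<lambda>w. max 0 (g n w - c w))" for n
      by (intro continuous_intros cont c_cont)
    show "0 < g n w" if "0 < max 0 (g n w - c w)" for n w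
      using that dyadic_mean_nonneg[of "\<lambda>n. g n w"] nonneg le_1
      by (auto simp: c_def less_max_iff_disj)
    show "\<exists>m. 0 < max 0 (g m u - c u)" if "0 < g n u" for n u
      using dyadic_mean_less[of "\<lambda>n. g n u", OF nonneg le_1 that]
      by (simp add: c_def less_max_iff_disj)
    show "\<exists>N. \<forall>\<^sub>F w in nhds u. \<forall>m\<ge>N. max 0 (g m w - c w) = 0" if pos: "0 < g n u" for n u
    proof -
      have "0 < c u"
        unfolding c_def using nonneg le_1 pos by (rule dyadic_mean_pos)
      then obtain N where N: "(1 / 2) ^ N < c u"
        using real_arch_pow_inv[of "c u" "1 / 2"] by auto
      have "open {w. (1 / 2) ^ N < c w}"
        by (intro open_Collect_less continuous_intros c_cont)
      with N have "\<forall>\<^sub>F w in nhds u. (1 / 2) ^ N < c w"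
        using eventually_nhds_in_open by fastforce
      then have "\<forall>\<^sub>F w in nhds u. \<forall>m\<ge>N. max 0 (g m w - c w) = 0"
      proof eventually_elim
        case (elim w)
        have "g m w \<le> c w" if "N \<le> m" for m
          using le[of m w] elim power_decreasing[OF that, of "1 / 2 :: real"] by linarith
        then show ?case by simp
      qed
      then show ?thesis ..
    qed
  qed simp
qed

lemma convex_normalized_sum:
  fixes c :: "nat \<Rightarrow> 'b::real_vector"
  assumes "finite I" "convex C" and nonneg: "\<And>n. n \<in> I \<Longrightarrow> 0 \<le> h n"
    and c: "\<And>n. n \<in> I \<Longrightarrow> 0 < h n \<Longrightarrow> c n \<in> C" and pos: "0 < (\<Sum>n\<in>I. h n)"
  shows "(\<Sum>n\<in>I. h n *\<^sub>R c n) /\<^sub>R (\<Sum>n\<in>I. h n) \<in> C"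
proof -
  define s where "s = (\<Sum>n\<in>I. h n)"
  define J where "J = {n \<in> I. 0 < h n}"
  have restrict: "(\<Sum>n\<in>I. h n *\<^sub>R x n) = (\<Sum>n\<in>J. h n *\<^sub>R x n)" for x :: "nat \<Rightarrow> 'c::real_vector"
    unfolding J_def using \<open>finite I\<close> nonneg
    by (intro sum.mono_neutral_right) (auto simp: order_le_less)
  have "(\<Sum>n\<in>J. (h n / s) *\<^sub>R c n) \<in> C"
  proof (rule convex_sum[OF _ \<open>convex C\<close>])
    show "(\<Sum>n\<in>J. h n / s) = 1"
      using restrict[of "\<lambda>_. 1 :: real"] pos by (simp add: s_def flip: sum_divide_distrib)
  qed (use \<open>finite I\<close> pos c in \<open>auto simp: J_def s_def\<close>)
  also have "(\<Sum>n\<in>J. (h n / s) *\<^sub>R c n) = (\<Sum>n\<in>I. h n *\<^sub>R c n) /\<^sub>R s"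
    unfolding restrict by (simp add: scaleR_sum_right divide_inverse_commute)
  finally show ?thesis by (simp add: s_def)
qed

lemma isCont_scaleR_locally_constant:
  fixes c :: "'a::t2_space \<Rightarrow> 'b::real_normed_vector"
  assumes "isCont h u" and nonneg: "\<And>w. 0 \<le> h w" and const: "\<exists>v. \<forall>\<^sub>F w in nhds u. 0 < h w \<longrightarrow> c w = v"
  shows "isCont (\<lambda>w. h w *\<^sub>R c w) u"
proof -
  obtain v where "\<forall>\<^sub>F w in nhds u. 0 < h w \<longrightarrow> c w = v"
    using const by blast
  then have eq: "\<forall>\<^sub>F w in nhds u. h w *\<^sub>R c w = h w *\<^sub>R v"
    using nonneg by (elim eventually_mono) (metis order_le_less scaleR_zero_left)
  show ?thesis
    unfolding isCont_cong[OF eq] by (intro continuous_intros assms(1))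
qed

lemma locally_finite_convex_combination:
  fixes h :: "nat \<Rightarrow> 'a::t2_space \<Rightarrow> real" and c :: "nat \<Rightarrow> 'a \<Rightarrow> 'b::real_normed_vector"
  assumes h_cont: "\<And>n. continuous_on UNIV (h n)" and h_nonneg: "\<And>n w. 0 \<le> h n w"
    and h_pos: "\<And>u. u \<in> W \<Longrightarrow> \<exists>n. 0 < h n u"
    and locally_finite: "\<And>u. u \<in> W \<Longrightarrow> \<exists>N. \<forall>\<^sub>F w in nhds u. \<forall>n\<ge>N. h n w = 0"
    and locally_const: "\<And>n u. \<exists>v. \<forall>\<^sub>F w in nhds u. 0 < h n w \<longrightarrow> c n w = v"
    and convex: "\<And>w. w \<in> W \<Longrightarrow> convex (\<Psi> w)"
    and c: "\<And>n w. w \<in> W \<Longrightarrow> 0 < h n w \<Longrightarrow> c n w \<in> \<Psi> w"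
  obtains f where "continuous_on W f" "\<And>w. w \<in> W \<Longrightarrow> f w \<in> \<Psi> w"
proof -
  have isCont_h: "isCont (h n) u" for n u
    using h_cont by (simp add: continuous_on_eq_continuous_at)
  define f where "f w = (\<Sum>n. h n w *\<^sub>R c n w) /\<^sub>R (\<Sum>n. h n w)" for w
  have finite_sum: "f w = (\<Sum>n<N. h n w *\<^sub>R c n w) /\<^sub>R (\<Sum>n<N. h n w)" if "\<forall>n\<ge>N. h n w = 0" for w N
    unfolding f_def using that
    by (subst (1 2) suminf_finite[of "{..<N}"]) (auto simp: not_less)
  have sum_pos: "0 < (\<Sum>n<N. h n w)" if w: "w \<in> W" and zero: "\<forall>n\<ge>N. h n w = 0" for w N
  proof -
    obtain m where "0 < h m w"
      using h_pos[OF w] by blast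
    moreover from this have "m < N"
      using zero by (metis less_irrefl not_less)
    ultimately show ?thesis
      using h_nonneg by (intro sum_pos2[of _ m]) auto
  qed
  have "isCont f u" if u: "u \<in> W" for u
  proof -
    obtain N where N: "\<forall>\<^sub>F w in nhds u. \<forall>n\<ge>N. h n w = 0"
      using locally_finite[OF u] by blast
    then have eq: "\<forall>\<^sub>F w in nhds u. f w = (\<Sum>n<N. h n w *\<^sub>R c n w) /\<^sub>R (\<Sum>n<N. h n w)"
      by (rule eventually_mono) (rule finite_sum)
    show ?thesis
      unfolding isCont_cong[OF eq] using sum_pos[OF u eventually_nhds_x_imp_x[OF N]]
      by (intro continuous_intros isCont_h isCont_scaleR_locally_constant h_nonneg locally_const)
        simp
  qed
  moreover have "f w \<in> \<Psi> w" if w: "w \<in> W" for w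
  proof -
    obtain N where N: "\<forall>n\<ge>N. h n w = 0"
      using locally_finite[OF w] eventually_nhds_x_imp_x by blast
    show ?thesis
      unfolding finite_sum[OF N]
      by (intro convex_normalized_sum sum_pos[OF w N] convex[OF w] c[OF w] h_nonneg) simp_all
  qed
  ultimately show thesis
    by (intro that[of f] continuous_at_imp_continuous_on) auto
qed

lemma ball_dyadic_subset:
  assumes "open U" "x \<in> U"
  shows "\<exists>n. ball x (C * (1 / 2) ^ n) \<subseteq> U"
proof -
  obtain e where "0 < e" "ball x e \<subseteq> U"
    using assms open_contains_ball by blast
  have "(\<lambda>n. C * (1 / 2) ^ n) \<longlonglongrightarrow> 0"
    by (intro tendsto_mult_right_zero LIMSEQ_power_zero) simp
  then obtain n where "C * (1 / 2) ^ n < e"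
    using order_tendstoD(2)[OF _ \<open>0 < e\<close>] eventually_happens'[OF sequentially_bot] by blast
  then have "ball x (C * (1 / 2) ^ n) \<subseteq> ball x e"
    by (intro subset_ball) simp
  with \<open>ball x e \<subseteq> U\<close> show ?thesis by blast
qed

lemma locally_constant_selections:
  fixes \<Psi> :: "'a::metric_space \<Rightarrow> 'b set"
  assumes local: "\<And>u. u \<in> W \<Longrightarrow> \<exists>v. \<forall>\<^sub>F w in nhds u. w \<in> W \<longrightarrow> v \<in> \<Psi> w"
  obtains g :: "nat \<Rightarrow> 'a \<Rightarrow> real" and c :: "nat \<Rightarrow> 'a \<Rightarrow> 'b"
  where "\<And>n. continuous_on UNIV (g n)" "\<And>n w. 0 \<le> g n w" "\<And>n w. g n w \<le> (1 / 2) ^ n"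
    and "\<And>w. w \<in> W \<Longrightarrow> \<exists>n. 0 < g n w"
    and "\<And>n w. w \<in> W \<Longrightarrow> 0 < g n w \<Longrightarrow> c n w \<in> \<Psi> w"
    and "\<And>n u. \<exists>v. \<forall>\<^sub>F w in nhds u. 0 < g n w \<longrightarrow> c n w = v"
proof -
  define U where "U v = interior {w. w \<in> W \<longrightarrow> v \<in> \<Psi> w}" for v
  have "W \<subseteq> (\<Union>v. U v)"
    using local by (force simp: U_def interior_def eventually_nhds)
  then obtain f where f: "\<And>x. x \<in> W \<Longrightarrow> x \<in> U (f x)"
    and f_eq: "\<And>x y r. \<lbrakk>x \<in> W; y \<in> W; ball x r \<subseteq> U (f x); ball y r \<subseteq> U (f y); dist x y < r\<rbrakk>
      \<Longrightarrow> f x = f y"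
    using least_index_cover by metis
  define \<rho> where "\<rho> n = (1 / 2 :: real) ^ n" for n :: nat
  define E where "E n = {x \<in> W. ball x (3 * \<rho> n) \<subseteq> U (f x)}" for n
  have \<rho>_pos: "0 < \<rho> n" for n
    by (simp add: \<rho>_def)
  show thesis
  proof (rule that[of "\<lambda>n. bump (\<rho> n) (E n)" "\<lambda>n. nearby_value (\<rho> n) (E n) f"])
    show "bump (\<rho> n) (E n) w \<le> (1 / 2) ^ n" for n w
      unfolding \<rho>_def by (rule bump_le) simp
    show "\<exists>n. 0 < bump (\<rho> n) (E n) x" if x: "x \<in> W" for x
    proof -
      have "open (U (f x))"
        by (simp add: U_def)
      then obtain n where "x \<in> E n"
        using ball_dyadic_subset[of "U (f x)" x 3] f x by (auto simp: E_def \<rho>_def)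
      then show ?thesis
        using bump_pos[OF \<rho>_pos] by blast
    qed
    show "nearby_value (\<rho> n) (E n) f w \<in> \<Psi> w" if w: "w \<in> W" "0 < bump (\<rho> n) (E n) w" for n w
    proof -
      obtain x where "x \<in> E n" "dist w x < \<rho> n" "nearby_value (\<rho> n) (E n) f w = f x"
        using nearby_valueE[OF w(2)] .
      moreover from this have "w \<in> ball x (3 * \<rho> n)"
        using \<rho>_pos[of n] by (simp add: dist_commute)
      ultimately have "w \<in> U (nearby_value (\<rho> n) (E n) f w)"
        by (auto simp: E_def)
      with w(1) show ?thesis
        using interior_subset unfolding U_def by blast
    qed
    show "\<exists>v. \<forall>\<^sub>F w in nhds u. 0 < bump (\<rho> n) (E n) w \<longrightarrow> nearby_value (\<rho> n) (E n) f w = v" for n u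
      using \<rho>_pos by (rule nearby_value_locally_constant) (use f_eq in \<open>auto simp: E_def\<close>)
  qed (rule continuous_on_bump bump_nonneg)+
qed

theorem continuous_convex_selection:
  fixes \<Psi> :: "'a::metric_space \<Rightarrow> 'b::real_normed_vector set"
  assumes convex: "\<And>w. w \<in> W \<Longrightarrow> convex (\<Psi> w)"
    and local: "\<And>u. u \<in> W \<Longrightarrow> \<exists>v. \<forall>\<^sub>F w in nhds u. w \<in> W \<longrightarrow> v \<in> \<Psi> w"
  obtains f where "continuous_on W f" "\<And>w. w \<in> W \<Longrightarrow> f w \<in> \<Psi> w"
proof -
  obtain g :: "nat \<Rightarrow> 'a \<Rightarrow> real" and c :: "nat \<Rightarrow> 'a \<Rightarrow> 'b"
    where g: "\<And>n. continuous_on UNIV (g n)" "\<And>n w. 0 \<le> g n w" "\<And>n w. g n w \<le> (1 / 2) ^ n"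
      and g_pos: "\<And>w. w \<in> W \<Longrightarrow> \<exists>n. 0 < g n w"
      and c: "\<And>n w. w \<in> W \<Longrightarrow> 0 < g n w \<Longrightarrow> c n w \<in> \<Psi> w"
      and c_const: "\<And>n u. \<exists>v. \<forall>\<^sub>F w in nhds u. 0 < g n w \<longrightarrow> c n w = v"
    by (rule locally_constant_selections[OF local], assumption, rule that; assumption)
  obtain h :: "nat \<Rightarrow> 'a \<Rightarrow> real"
    where h: "\<And>n. continuous_on UNIV (h n)" "\<And>n w. 0 \<le> h n w" "\<And>n w. 0 < h n w \<Longrightarrow> 0 < g n w"
      and h_pos: "\<And>n u. 0 < g n u \<Longrightarrow> \<exists>m. 0 < h m u"
      and h_finite: "\<And>n u. 0 < g n u \<Longrightarrow> \<exists>N. \<forall>\<^sub>F w in nhds u. \<forall>m\<ge>N. h m w = 0"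
    by (rule locally_finite_bumps[OF g], rule that; assumption)
  have h_pos_on_W: "\<exists>n. 0 < h n u" if "u \<in> W" for u
    using g_pos[OF that] h_pos by blast
  have h_finite_on_W: "\<exists>N. \<forall>\<^sub>F w in nhds u. \<forall>n\<ge>N. h n w = 0" if "u \<in> W" for u
    using g_pos[OF that] h_finite by blast
  have h_const: "\<exists>v. \<forall>\<^sub>F w in nhds u. 0 < h n w \<longrightarrow> c n w = v" for n u
  proof -
    obtain v where "\<forall>\<^sub>F w in nhds u. 0 < g n w \<longrightarrow> c n w = v"
      using c_const by blast
    then have "\<forall>\<^sub>F w in nhds u. 0 < h n w \<longrightarrow> c n w = v"
      by (rule eventually_mono) (use h(3) in blast)
    then show ?thesis ..
  qed
  show thesis
    by (rule locally_finite_convex_combination[OF h(1,2) h_pos_on_W h_finite_on_W h_const convex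
          c[OF _ h(3)]]) (assumption+, rule that)
qed

section \<open>Euler steps along a descent field\<close>

lemma convex_sublinear_less:
  assumes "sublinear p"
  shows "convex {v. p v < c}"
proof (rule convexI)
  fix x y and s t :: real
  assume "x \<in> {v. p v < c}" "y \<in> {v. p v < c}" and st: "0 \<le> s" "0 \<le> t" "s + t = 1"
  have "p (s *\<^sub>R x + t *\<^sub>R y) \<le> p (s *\<^sub>R x) + p (t *\<^sub>R y)"
    using assms by (rule sublinear_add)
  also have "\<dots> = s * p x + t * p y"
    using assms st by (simp add: sublinear_scaleR)
  also have "\<dots> < c"
    using \<open>x \<in> _\<close> \<open>y \<in> _\<close> st by (intro convex_bound_lt) auto
  finally show "s *\<^sub>R x + t *\<^sub>R y \<in> {v. p v < c}" by simp
qed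

lemma continuous_on_eventually_less:
  fixes k :: "'a::t2_space \<Rightarrow> real"
  assumes "continuous_on N k" "open N" "u \<in> N" "k u < c"
  shows "\<forall>\<^sub>F w in nhds u. k w < c"
proof -
  have "(k \<longlongrightarrow> k u) (nhds u)"
    using assms(1-3)
    by (simp add: continuous_on_eq_continuous_at isCont_def flip: tendsto_at_iff_tendsto_nhds)
  then show ?thesis
    using assms(4) by (rule order_tendstoD)
qed

lemma continuous_descent_field:
  assumes lip: "locally_lipschitz \<phi>" and N: "open N" and k_cont: "continuous_on N k"
    and k: "\<And>u. u \<in> N \<Longrightarrow> 0 \<le> k u" "\<And>u. u \<in> N \<Longrightarrow> k u < mnorm \<phi> u"
  obtains V where "continuous_on N V"
    and "\<And>u. u \<in> N \<Longrightarrow> norm (V u) \<le> 1" "\<And>u. u \<in> N \<Longrightarrow> clarke_dd \<phi> u (V u) < - k u"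
proof -
  define D where "D u = cball 0 1 \<inter> {v. clarke_dd \<phi> u v < - k u}" for u
  have "convex (D u)" for u
    unfolding D_def by (intro convex_Int convex_cball convex_sublinear_less sublinear_clarke_dd lip)
  moreover have "\<exists>v. \<forall>\<^sub>F w in nhds u. w \<in> N \<longrightarrow> v \<in> D w" if u: "u \<in> N" for u
  proof -
    obtain v where v: "norm v \<le> 1" "clarke_dd \<phi> u v < - k u"
      using descent_direction[OF lip k(1,2)[OF u]] by metis
    obtain c where c: "clarke_dd \<phi> u v < - c" "k u < c"
      using dense[OF v(2)] by (metis minus_less_iff minus_minus)
    from clarke_dd_upper_semicontinuous[OF lip c(1)]
      continuous_on_eventually_less[OF k_cont N u c(2)]
    have "\<forall>\<^sub>F w in nhds u. w \<in> N \<longrightarrow> v \<in> D w"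
      by eventually_elim (use v(1) in \<open>auto simp: D_def\<close>)
    then show ?thesis ..
  qed
  ultimately obtain V where "continuous_on N V" "\<And>u. u \<in> N \<Longrightarrow> V u \<in> D u"
    using continuous_convex_selection[of N D] by blast
  then show thesis
    by (intro that[of V]) (auto simp: D_def)
qed

definition descent_segment ::
    "('a::real_vector \<Rightarrow> real) \<Rightarrow> ('a \<Rightarrow> real) \<Rightarrow> 'a set \<Rightarrow> 'a \<Rightarrow> 'a \<Rightarrow> real \<Rightarrow> bool" where
  "descent_segment \<phi> k N u v d \<longleftrightarrow> (\<forall>s t. 0 \<le> s \<longrightarrow> s \<le> t \<longrightarrow> t \<le> d \<longrightarrow>
     u + t *\<^sub>R v \<in> N \<and> k (u + s *\<^sub>R v) * (t - s) \<le> \<phi> (u + s *\<^sub>R v) - \<phi> (u + t *\<^sub>R v))"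

lemma descent_segment_mono: "descent_segment \<phi> k N u v d \<Longrightarrow> d' \<le> d \<Longrightarrow> descent_segment \<phi> k N u v d'"
  unfolding descent_segment_def by (meson order_trans)

lemma descent_segment_in: "descent_segment \<phi> k N u v d \<Longrightarrow> t \<in> {0..d} \<Longrightarrow> u + t *\<^sub>R v \<in> N"
  by (auto simp: descent_segment_def)

lemma descent_segment_drop:
  assumes "descent_segment \<phi> k N u v d" "0 \<le> s" "s \<le> t" "t \<le> d"
  shows "k (u + s *\<^sub>R v) * (t - s) \<le> \<phi> (u + s *\<^sub>R v) - \<phi> (u + t *\<^sub>R v)"
  using assms by (simp add: descent_segment_def)

lemma descent_segment_drop_dist:
  fixes u v :: "'a::real_normed_vector"
  assumes segment: "descent_segment \<phi> k N u v d" and "norm v \<le> 1" and k: "\<And>w. w \<in> N \<Longrightarrow> 0 \<le> k w"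
    and st: "0 \<le> s" "s \<le> t" "t \<le> d"
  shows "k (u + s *\<^sub>R v) * dist (u + s *\<^sub>R v) (u + t *\<^sub>R v) \<le> \<phi> (u + s *\<^sub>R v) - \<phi> (u + t *\<^sub>R v)"
proof -
  have "dist (u + s *\<^sub>R v) (u + t *\<^sub>R v) = (t - s) * norm v"
    using st by (simp add: dist_norm norm_minus_commute flip: scaleR_diff_left)
  also have "\<dots> \<le> t - s"
    using st \<open>norm v \<le> 1\<close> by (simp add: mult_left_le)
  finally have "k (u + s *\<^sub>R v) * dist (u + s *\<^sub>R v) (u + t *\<^sub>R v) \<le> k (u + s *\<^sub>R v) * (t - s)"
    using st by (intro mult_left_mono k descent_segment_in[OF segment]) auto
  also have "\<dots> \<le> \<phi> (u + s *\<^sub>R v) - \<phi> (u + t *\<^sub>R v)"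
    using segment st by (rule descent_segment_drop)
  finally show ?thesis .
qed

lemma eventually_nhds_interval:
  assumes "\<forall>\<^sub>F (y, s, t) in nhds (p, 0 :: real, 0 :: real). 0 \<le> s \<longrightarrow> s \<le> t \<longrightarrow> P y s t"
  shows "\<exists>d>0. \<forall>\<^sub>F y in nhds p. \<forall>s t. 0 \<le> s \<longrightarrow> s \<le> t \<longrightarrow> t \<le> d \<longrightarrow> P y s t"
proof -
  obtain Q R where Q: "\<forall>\<^sub>F y in nhds p. Q y" and R: "\<forall>\<^sub>F r in nhds (0 :: real). R r"
    and P: "\<And>y s t. \<lbrakk>Q y; R s; R t; 0 \<le> s; s \<le> t\<rbrakk> \<Longrightarrow> P y s t"
    using assms
    unfolding nhds_prod eventually_prod_filter[of _ _ "_ \<times>\<^sub>F _"] eventually_prod_same by fastforce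
  obtain d where "0 < d" and d: "\<And>r. dist r 0 \<le> d \<Longrightarrow> R r"
    using R unfolding eventually_nhds_metric_le by auto
  have R': "R r" if "0 \<le> r" "r \<le> d" for r
    using d[of r] that by simp
  from Q have "\<forall>\<^sub>F y in nhds p. \<forall>s t. 0 \<le> s \<longrightarrow> s \<le> t \<longrightarrow> t \<le> d \<longrightarrow> P y s t"
  proof eventually_elim
    case (elim y)
    show ?case
    proof (intro allI impI)
      fix s t assume "0 \<le> s" "s \<le> t" "t \<le> d"
      then show "P y s t"
        by (intro P elim R') linarith+
    qed
  qed
  with \<open>0 < d\<close> show ?thesis by blast
qed

lemma eventually_descent_segment:
  assumes lip: "locally_lipschitz \<phi>" and N: "open N" "u \<in> N" and k_cont: "continuous_on N k"
    and descent: "clarke_dd \<phi> u v < - k u"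
  shows "\<exists>d>0. \<forall>\<^sub>F (w, v') in nhds (u, v). descent_segment \<phi> k N w v' d"
proof -
  obtain \<kappa> where \<kappa>: "clarke_dd \<phi> u v < - \<kappa>" "k u < \<kappa>"
    using dense[OF descent] by (metis minus_less_iff minus_minus)
  from eventually_nhds_in_open[OF N] continuous_on_eventually_less[OF k_cont N \<kappa>(2)]
  have near: "\<forall>\<^sub>F w in nhds u. w \<in> {w \<in> N. k w < \<kappa>}"
    by eventually_elim simp
  let ?p = "\<lambda>r x. fst (fst x) + r x *\<^sub>R snd (fst x)"
  let ?s = "\<lambda>x. fst (snd x)" and ?t = "\<lambda>x. snd (snd x)"
  have "\<forall>\<^sub>F x in nhds ((u, v), (0, 0 :: real)). case (?p ?s x, snd (fst x), ?t x - ?s x) of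
      (w, v', t) \<Rightarrow> 0 < t \<longrightarrow> \<phi> (w + t *\<^sub>R v') - \<phi> w < - \<kappa> * t"
    by (intro eventually_nhds_isCont[OF eventually_increment_less[OF lip \<kappa>(1)]] continuous_intros)
      simp
  moreover have "\<forall>\<^sub>F x in nhds ((u, v), (0, 0 :: real)). ?p ?s x \<in> {w \<in> N. k w < \<kappa>}"
    by (intro eventually_nhds_isCont[OF near] continuous_intros) simp
  moreover have "\<forall>\<^sub>F x in nhds ((u, v), (0 :: real, 0)). ?p ?t x \<in> {w \<in> N. k w < \<kappa>}"
    by (intro eventually_nhds_isCont[OF near] continuous_intros) simp
  ultimately have "\<forall>\<^sub>F (y, s, t) in nhds ((u, v), (0, 0)). 0 \<le> s \<longrightarrow> s \<le> t \<longrightarrow>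
      fst y + t *\<^sub>R snd y \<in> N \<and>
      k (fst y + s *\<^sub>R snd y) * (t - s) \<le> \<phi> (fst y + s *\<^sub>R snd y) - \<phi> (fst y + t *\<^sub>R snd y)"
  proof eventually_elim
    case (elim x)
    obtain w v' s t where x: "x = ((w, v'), (s, t))"
      by (metis surj_pair)
    have "k (w + s *\<^sub>R v') * (t - s) \<le> \<phi> (w + s *\<^sub>R v') - \<phi> (w + t *\<^sub>R v')" if "s < t"
    proof -
      have "k (w + s *\<^sub>R v') * (t - s) \<le> \<kappa> * (t - s)"
        using elim(2) that by (intro mult_right_mono) (auto simp: x)
      also have "\<dots> \<le> \<phi> (w + s *\<^sub>R v') - \<phi> (w + t *\<^sub>R v')"
        using elim(1) that by (simp add: x algebra_simps)
      finally show ?thesis .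
    qed
    then show ?case
      using elim(3) by (cases "s = t") (auto simp: x)
  qed
  from eventually_nhds_interval[OF this] show ?thesis
    by (simp add: descent_segment_def case_prod_unfold)
qed

lemma continuous_step_size:
  assumes lip: "locally_lipschitz \<phi>" and N: "open N" and k_cont: "continuous_on N k"
    and V_cont: "continuous_on N V" and descent: "\<And>u. u \<in> N \<Longrightarrow> clarke_dd \<phi> u (V u) < - k u"
  obtains \<tau> where "continuous_on N \<tau>" "\<And>u. u \<in> N \<Longrightarrow> 0 < \<tau> u"
    and "\<And>u. u \<in> N \<Longrightarrow> descent_segment \<phi> k N u (V u) (\<tau> u)"
proof -
  define D where "D u = {d. 0 < d \<and> descent_segment \<phi> k N u (V u) d}" for u
  have "convex (D u)" for u
    by (auto simp: D_def is_interval_1 intro: descent_segment_mono simp flip: is_interval_convex_1)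
  moreover have "\<exists>d. \<forall>\<^sub>F w in nhds u. w \<in> N \<longrightarrow> d \<in> D w" if u: "u \<in> N" for u
  proof -
    obtain d where d: "0 < d" "\<forall>\<^sub>F (w, v) in nhds (u, V u). descent_segment \<phi> k N w v d"
      using eventually_descent_segment[OF lip N u k_cont descent[OF u]] by blast
    have "isCont V u"
      using V_cont N u by (simp add: continuous_on_eq_continuous_at)
    then have "isCont (\<lambda>w. (w, V w)) u"
      by (intro continuous_intros)
    then have "\<forall>\<^sub>F w in nhds u. case (w, V w) of (w, v) \<Rightarrow> descent_segment \<phi> k N w v d"
      by (rule eventually_nhds_isCont[OF d(2)]) (rule refl)
    then show ?thesis
      by (intro exI[of _ d]) (auto simp: D_def d(1) elim: eventually_mono)
  qed
  ultimately obtain \<tau> where "continuous_on N \<tau>" "\<And>u. u \<in> N \<Longrightarrow> \<tau> u \<in> D u"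
    using continuous_convex_selection[of N D] by blast
  then show thesis
    by (intro that[of \<tau>]) (auto simp: D_def)
qed

locale self_homotopy =
  fixes N :: "'a::topological_space set" and S :: "real \<Rightarrow> 'a \<Rightarrow> 'a"
  assumes continuous_on_step: "continuous_on ({0..1} \<times> N) (\<lambda>(r, u). S r u)"
    and step_0: "u \<in> N \<Longrightarrow> S 0 u = u"
    and step_in: "r \<in> {0..1} \<Longrightarrow> u \<in> N \<Longrightarrow> S r u \<in> N"

lemma euler_step:
  assumes lip: "locally_lipschitz \<phi>" and N: "open N" and k_cont: "continuous_on N k"
    and k: "\<And>u. u \<in> N \<Longrightarrow> 0 < k u" "\<And>u. u \<in> N \<Longrightarrow> k u < mnorm \<phi> u"
  obtains S where "self_homotopy N S" "\<And>u. u \<in> N \<Longrightarrow> \<phi> (S 1 u) < \<phi> u"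
    and "\<And>u r s. \<lbrakk>u \<in> N; 0 \<le> r; r \<le> s; s \<le> 1\<rbrakk> \<Longrightarrow>
      k (S r u) * dist (S r u) (S s u) \<le> \<phi> (S r u) - \<phi> (S s u)"
proof -
  obtain V where V: "continuous_on N V" "\<And>u. u \<in> N \<Longrightarrow> norm (V u) \<le> 1"
      "\<And>u. u \<in> N \<Longrightarrow> clarke_dd \<phi> u (V u) < - k u"
    using continuous_descent_field[OF lip N k_cont less_imp_le[OF k(1)] k(2)] by blast
  obtain \<tau> where \<tau>: "continuous_on N \<tau>" "\<And>u. u \<in> N \<Longrightarrow> 0 < \<tau> u"
      "\<And>u. u \<in> N \<Longrightarrow> descent_segment \<phi> k N u (V u) (\<tau> u)"
    using continuous_step_size[OF lip N k_cont V(1,3)] by blast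
  define S where "S r u = u + (r * \<tau> u) *\<^sub>R V u" for r u
  have scale: "0 \<le> r * \<tau> u" "r * \<tau> u \<le> s * \<tau> u" "s * \<tau> u \<le> \<tau> u"
    if "u \<in> N" "0 \<le> r" "r \<le> s" "s \<le> 1" for u r s
    using that \<tau>(2)[OF that(1)] by (auto intro: mult_right_mono)
  show thesis
  proof (rule that[of S])
    show "self_homotopy N S"
    proof
      have "continuous_on ({0..1} \<times> N) (\<lambda>x. snd x + (fst x * \<tau> (snd x)) *\<^sub>R V (snd x))"
        by (intro continuous_intros continuous_on_compose2[OF V(1)]
            continuous_on_compose2[OF \<tau>(1)]) auto
      then show "continuous_on ({0..1} \<times> N) (\<lambda>(r, u). S r u)"
        by (simp add: S_def case_prod_unfold)
      show "S r u \<in> N" if "r \<in> {0..1}" "u \<in> N" for r u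
        unfolding S_def using that scale[of u r r] by (intro descent_segment_in[OF \<tau>(3)]) auto
    qed (simp add: S_def)
    show "\<phi> (S 1 u) < \<phi> u" if u: "u \<in> N" for u
    proof -
      have "0 < k u * \<tau> u"
        using k(1) \<tau>(2) u by simp
      also have "\<dots> \<le> \<phi> u - \<phi> (S 1 u)"
        using descent_segment_drop[OF \<tau>(3)[OF u], of 0 "\<tau> u"] \<tau>(2)[OF u] by (simp add: S_def)
      finally show ?thesis by simp
    qed
    show "k (S r u) * dist (S r u) (S s u) \<le> \<phi> (S r u) - \<phi> (S s u)"
      if "u \<in> N" "0 \<le> r" "r \<le> s" "s \<le> 1" for u r s
      unfolding S_def using scale[OF that] V(2) k(1) that(1)
      by (intro descent_segment_drop_dist[OF \<tau>(3)]) (auto intro: less_imp_le)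
  qed
qed

section \<open>Iterating a homotopy\<close>

context self_homotopy
begin

definition flow :: "real \<Rightarrow> 'a \<Rightarrow> 'a" where
  "flow s u = S (frac s) ((S 1 ^^ nat \<lfloor>s\<rfloor>) u)"

lemma vertex_in: "u \<in> N \<Longrightarrow> (S 1 ^^ n) u \<in> N"
  by (induction n) (auto intro: step_in)

lemma flow_in: "u \<in> N \<Longrightarrow> flow s u \<in> N"
  by (auto simp: flow_def frac_ge_0 frac_lt_1 less_imp_le intro: step_in vertex_in)

lemma flow_edge:
  assumes u: "u \<in> N" and r: "0 \<le> r" "r \<le> 1"
  shows "flow (real n + r) u = S r ((S 1 ^^ n) u)"
proof (cases "r = 1")
  case True
  then have "flow (real n + r) u = S 0 ((S 1 ^^ Suc n) u)"
    by (simp add: flow_def frac_def nat_add_distrib)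
  with True show ?thesis
    using step_0[OF vertex_in[OF u, of "Suc n"]] by simp
next
  case False
  with r have "\<lfloor>real n + r\<rfloor> = int n"
    by (simp add: floor_unique)
  then show ?thesis
    by (simp add: flow_def frac_def)
qed

lemma flow_of_nat: "u \<in> N \<Longrightarrow> flow (real n) u = (S 1 ^^ n) u"
  using flow_edge[of u 0 n] step_0[OF vertex_in] by simp

lemma flow_0: "u \<in> N \<Longrightarrow> flow 0 u = u"
  using flow_of_nat[of u 0] by simp

lemma continuous_on_vertex: "continuous_on N (\<lambda>u. (S 1 ^^ n) u)"
proof (induction n)
  case (Suc n)
  have "continuous_on N (\<lambda>u. (1 :: real, (S 1 ^^ n) u))"
    using Suc by (intro continuous_intros)
  then have "continuous_on N (\<lambda>u. case (1, (S 1 ^^ n) u) of (r, u) \<Rightarrow> S r u)"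
    by (rule continuous_on_compose2[OF continuous_on_step]) (auto intro: vertex_in)
  then show ?case by simp
qed simp

lemma continuous_on_flow_edge: "continuous_on ({real n..real n + 1} \<times> N) (\<lambda>(s, u). flow s u)"
proof -
  have "continuous_on ({real n..real n + 1} \<times> N) (\<lambda>x. (fst x - real n, (S 1 ^^ n) (snd x)))"
    by (intro continuous_intros continuous_on_compose2[OF continuous_on_vertex]) auto
  then have "continuous_on ({real n..real n + 1} \<times> N)
      (\<lambda>x. case (fst x - real n, (S 1 ^^ n) (snd x)) of (r, u) \<Rightarrow> S r u)"
    by (rule continuous_on_compose2[OF continuous_on_step]) (auto intro: vertex_in)
  then show ?thesis
  proof (rule continuous_on_eq)
    fix x assume "x \<in> {real n..real n + 1} \<times> N"
    then show "(case (fst x - real n, (S 1 ^^ n) (snd x)) of (r, u) \<Rightarrow> S r u) =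
        (case x of (s, u) \<Rightarrow> flow s u)"
      using flow_edge[of "snd x" "fst x - real n" n] by auto
  qed
qed

lemma continuous_on_flow_up_to: "continuous_on ({0..real n} \<times> N) (\<lambda>(s, u). flow s u)"
proof (induction n)
  case 0
  have "continuous_on ({0..real 0} \<times> N) snd"
    by (intro continuous_intros)
  then show ?case
    by (rule continuous_on_eq) (auto simp: flow_0)
next
  case (Suc n)
  have split: "{0..real (Suc n)} \<times> N = {0..real n} \<times> N \<union> {real n..real n + 1} \<times> N"
    by auto
  have closedin: "closedin (top_of_set ({0..real (Suc n)} \<times> N)) (C \<times> N)"
    if "closed C" "C \<subseteq> {0..real (Suc n)}" for C
    using closedin_closed_Int[of "C \<times> UNIV" "{0..real (Suc n)} \<times> N"] that
    by (simp add: closed_Times Times_Int_Times Int_absorb1 Int_absorb2)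
  show ?case
    unfolding split
    by (rule continuous_on_Un_local[OF _ _ Suc continuous_on_flow_edge])
      (unfold split[symmetric], (rule closedin; auto)+)
qed

lemma continuous_on_flow: "continuous_on ({0..} \<times> N) (\<lambda>(s, u). flow s u)"
  unfolding continuous_on_def
proof
  fix x assume x: "x \<in> {0::real..} \<times> N"
  obtain n where n: "fst x < real n"
    using reals_Archimedean2 by blast
  have "at x within {0..} \<times> N = at x within {0..real n} \<times> N"
    by (rule at_within_nhd[of _ "{..<real n} \<times> UNIV"])
      (use n in \<open>auto simp: open_Times mem_Times_iff\<close>)
  moreover have "x \<in> {0..real n} \<times> N"
    using x n by (auto simp: mem_Times_iff)
  ultimately show "((\<lambda>(s, u). flow s u) \<longlongrightarrow> (case x of (s, u) \<Rightarrow> flow s u)) (at x within {0..} \<times> N)"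
    using continuous_on_flow_up_to[of n] unfolding continuous_on_def by metis
qed

end

section \<open>Flows attracted to a stable set\<close>

locale attracting_flow =
  fixes \<sigma> :: "real \<Rightarrow> 'a::metric_space \<Rightarrow> 'a" and W A :: "'a set"
  assumes disjoint: "W \<inter> A = {}"
    and openin_W: "openin (top_of_set (W \<union> A)) W"
    and continuous_on_\<sigma>: "continuous_on ({0..} \<times> W) (\<lambda>(s, u). \<sigma> s u)"
    and \<sigma>_0: "u \<in> W \<Longrightarrow> \<sigma> 0 u = u"
    and stable: "z \<in> A \<Longrightarrow> 0 < e \<Longrightarrow> \<exists>d>0. \<forall>u\<in>W. \<forall>s\<ge>0. dist (\<sigma> s u) z < d \<longrightarrow> (\<forall>t\<ge>s. dist (\<sigma> t u) z < e)"
    and attracted: "u \<in> W \<Longrightarrow> \<exists>z\<in>A. ((\<lambda>s. \<sigma> s u) \<longlongrightarrow> z) at_top"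
begin

lemma tendsto_\<sigma>:
  assumes f: "(f \<longlongrightarrow> s) F" and g: "(g \<longlongrightarrow> u) F" and "0 \<le> s" "u \<in> W"
    and "\<forall>\<^sub>F x in F. 0 \<le> f x \<and> g x \<in> W"
  shows "((\<lambda>x. \<sigma> (f x) (g x)) \<longlongrightarrow> \<sigma> s u) F"
proof -
  have "((\<lambda>x. case (f x, g x) of (s, u) \<Rightarrow> \<sigma> s u) \<longlongrightarrow> (case (s, u) of (s, u) \<Rightarrow> \<sigma> s u)) F"
    using assms by (intro continuous_on_tendsto_compose[OF continuous_on_\<sigma>] tendsto_Pair) auto
  then show ?thesis by simp
qed

definition endpoint :: "'a \<Rightarrow> 'a" where
  "endpoint u = (SOME z. z \<in> A \<and> ((\<lambda>s. \<sigma> s u) \<longlongrightarrow> z) at_top)"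

lemma
  assumes "u \<in> W"
  shows endpoint_in: "endpoint u \<in> A" and tendsto_endpoint: "((\<lambda>s. \<sigma> s u) \<longlongrightarrow> endpoint u) at_top"
  using someI_ex[OF attracted[OF assms, unfolded Bex_def]] by (simp_all add: endpoint_def)

definition homotopy :: "real \<Rightarrow> 'a \<Rightarrow> 'a" where
  "homotopy t u = (if u \<in> A then u else if t < 1 then \<sigma> (t / (1 - t)) u else endpoint u)"

lemma homotopy_fixed: "u \<in> A \<Longrightarrow> homotopy t u = u"
  by (simp add: homotopy_def)

lemma homotopy_interior: "u \<in> W \<Longrightarrow> t < 1 \<Longrightarrow> homotopy t u = \<sigma> (t / (1 - t)) u"
  using disjoint by (auto simp: homotopy_def)

lemma homotopy_1: "u \<in> W \<Longrightarrow> homotopy 1 u = endpoint u"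
  using disjoint by (auto simp: homotopy_def)

lemma homotopy_0: "u \<in> W \<union> A \<Longrightarrow> homotopy 0 u = u"
  using homotopy_fixed homotopy_interior[of u 0] \<sigma>_0 by auto

lemma homotopy_1_in: "u \<in> W \<union> A \<Longrightarrow> homotopy 1 u \<in> A"
  using homotopy_fixed homotopy_1 endpoint_in by auto

lemma dist_homotopy_le:
  assumes u: "u \<in> W" and s: "0 \<le> s" and t: "s / (1 + s) \<le> t" "t \<le> 1"
    and near: "\<And>r. s \<le> r \<Longrightarrow> dist (\<sigma> r u) z \<le> e"
  shows "dist (homotopy t u) z \<le> e"
proof (cases "t < 1")
  case True
  then have "s \<le> t / (1 - t)"
    using t(1) s by (simp add: field_simps)
  with u True show ?thesis
    by (simp add: homotopy_interior near)
next
  case False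
  have "\<forall>\<^sub>F r in at_top. dist (\<sigma> r u) z \<le> e"
    using near unfolding eventually_at_top_linorder by blast
  with tendsto_dist[OF tendsto_endpoint[OF u] tendsto_const] have "dist (endpoint u) z \<le> e"
    by (rule tendsto_upperbound) simp
  with u t(2) False show ?thesis
    by (simp add: homotopy_1)
qed

lemma dist_homotopy_less:
  assumes z: "z \<in> A" and e: "0 < e"
  obtains d where "0 < d"
    "\<And>u s t. \<lbrakk>u \<in> W; 0 \<le> s; dist (\<sigma> s u) z < d; s / (1 + s) \<le> t; t \<le> 1\<rbrakk> \<Longrightarrow> dist (homotopy t u) z < e"
proof -
  obtain d where "0 < d"
    and d: "\<And>u s t. \<lbrakk>u \<in> W; 0 \<le> s; dist (\<sigma> s u) z < d; s \<le> t\<rbrakk> \<Longrightarrow> dist (\<sigma> t u) z < e / 2"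
    using stable[OF z, of "e / 2"] e by auto
  have "dist (homotopy t u) z < e"
    if "u \<in> W" "0 \<le> s" "dist (\<sigma> s u) z < d" "s / (1 + s) \<le> t" "t \<le> 1" for u s t
  proof -
    have "dist (homotopy t u) z \<le> e / 2"
      using d[OF that(1-3)] by (intro dist_homotopy_le[OF that(1,2,4,5)]) (simp add: less_imp_le)
    with e show ?thesis by simp
  qed
  with \<open>0 < d\<close> that show thesis by blast
qed

lemma eventually_in_W:
  assumes "u \<in> W"
  shows "\<forall>\<^sub>F x in at (t, u) within {0..1} \<times> (W \<union> A). x \<in> {0..1} \<times> W"
proof -
  obtain T where T: "open T" "W = (W \<union> A) \<inter> T"
    using openin_W by (auto simp: openin_open)
  then have "\<forall>\<^sub>F x in at (t, u) within {0..1} \<times> (W \<union> A). x \<in> UNIV \<times> T"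
    using assms by (intro topological_tendstoD[OF tendsto_ident_at]) (auto intro: open_Times)
  moreover have "\<forall>\<^sub>F x in at (t, u) within {0..1} \<times> (W \<union> A). x \<in> {0..1} \<times> (W \<union> A)"
    by (simp add: eventually_at_filter)
  ultimately show ?thesis
    by eventually_elim (use T(2) in auto)
qed

lemma tendsto_homotopy_interior:
  assumes t: "0 \<le> t" "t < 1" and u: "u \<in> W"
  shows "((\<lambda>x. homotopy (fst x) (snd x)) \<longlongrightarrow> homotopy t u) (at (t, u) within {0..1} \<times> (W \<union> A))"
    (is "(_ \<longlongrightarrow> _) ?F")
proof -
  have fst: "(fst \<longlongrightarrow> t) ?F" and snd: "(snd \<longlongrightarrow> u) ?F"
    using tendsto_fst[OF tendsto_ident_at] tendsto_snd[OF tendsto_ident_at] by force+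
  have inside: "\<forall>\<^sub>F x in ?F. fst x < 1"
    using fst t(2) by (rule order_tendstoD)
  have "((\<lambda>x. fst x / (1 - fst x)) \<longlongrightarrow> t / (1 - t)) ?F"
    using t(2) by (intro tendsto_intros fst) auto
  moreover have "\<forall>\<^sub>F x in ?F. 0 \<le> fst x / (1 - fst x) \<and> snd x \<in> W"
    using eventually_in_W[OF u] inside by eventually_elim auto
  ultimately have "((\<lambda>x. \<sigma> (fst x / (1 - fst x)) (snd x)) \<longlongrightarrow> \<sigma> (t / (1 - t)) u) ?F"
    using t u by (intro tendsto_\<sigma> snd) auto
  moreover have "\<forall>\<^sub>F x in ?F. \<sigma> (fst x / (1 - fst x)) (snd x) = homotopy (fst x) (snd x)"
    using eventually_in_W[OF u] inside by eventually_elim (auto simp: homotopy_interior)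
  ultimately show ?thesis
    using t u by (simp add: homotopy_interior Lim_transform_eventually)
qed

lemma tendsto_homotopy_endpoint:
  assumes u: "u \<in> W"
  shows "((\<lambda>x. homotopy (fst x) (snd x)) \<longlongrightarrow> homotopy 1 u) (at (1, u) within {0..1} \<times> (W \<union> A))"
    (is "(_ \<longlongrightarrow> _) ?F")
proof (rule tendstoI)
  fix e :: real assume "0 < e"
  then obtain d where "0 < d" and d: "\<And>v s t. \<lbrakk>v \<in> W; 0 \<le> s; dist (\<sigma> s v) (endpoint u) < d;
      s / (1 + s) \<le> t; t \<le> 1\<rbrakk> \<Longrightarrow> dist (homotopy t v) (endpoint u) < e"
    using dist_homotopy_less[OF endpoint_in[OF u]] by metis
  have "\<forall>\<^sub>F s in at_top. dist (\<sigma> s u) (endpoint u) < d \<and> 0 \<le> s"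
    using tendstoD[OF tendsto_endpoint[OF u] \<open>0 < d\<close>] eventually_ge_at_top by (rule eventually_conj)
  then obtain s where s: "dist (\<sigma> s u) (endpoint u) < d" "0 \<le> s"
    using eventually_happens'[OF trivial_limit_at_top_linorder] by blast
  have fst: "(fst \<longlongrightarrow> 1) ?F" and snd: "(snd \<longlongrightarrow> u) ?F"
    using tendsto_fst[OF tendsto_ident_at] tendsto_snd[OF tendsto_ident_at] by force+
  have "\<forall>\<^sub>F x in ?F. 0 \<le> s \<and> snd x \<in> W"
    using eventually_in_W[OF u] by eventually_elim (use s(2) in auto)
  then have "((\<lambda>x. \<sigma> s (snd x)) \<longlongrightarrow> \<sigma> s u) ?F"
    by (intro tendsto_\<sigma> tendsto_const snd s(2) u)
  from tendsto_dist[OF this tendsto_const] s(1)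
  have "\<forall>\<^sub>F x in ?F. dist (\<sigma> s (snd x)) (endpoint u) < d"
    by (rule order_tendstoD)
  moreover have "\<forall>\<^sub>F x in ?F. s / (1 + s) < fst x"
    using fst by (rule order_tendstoD) (use s(2) in simp)
  ultimately show "\<forall>\<^sub>F x in ?F. dist (homotopy (fst x) (snd x)) (homotopy 1 u) < e"
    using eventually_in_W[OF u]
    by eventually_elim (use d s(2) u in \<open>auto simp: homotopy_1\<close>)
qed

lemma tendsto_homotopy_fixed:
  assumes z: "z \<in> A"
  shows "((\<lambda>x. homotopy (fst x) (snd x)) \<longlongrightarrow> homotopy t z) (at (t, z) within {0..1} \<times> (W \<union> A))"
    (is "(_ \<longlongrightarrow> _) ?F")
proof (rule tendstoI)
  fix e :: real assume e: "0 < e"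
  then obtain d where "0 < d" and d: "\<And>v s t. \<lbrakk>v \<in> W; 0 \<le> s; dist (\<sigma> s v) z < d;
      s / (1 + s) \<le> t; t \<le> 1\<rbrakk> \<Longrightarrow> dist (homotopy t v) z < e"
    using dist_homotopy_less[OF z] by metis
  have "(snd \<longlongrightarrow> z) ?F"
    using tendsto_snd[OF tendsto_ident_at] by force
  then have "\<forall>\<^sub>F x in ?F. dist (snd x) z < min d e"
    by (rule tendstoD) (use \<open>0 < d\<close> e in simp)
  moreover have "\<forall>\<^sub>F x in ?F. x \<in> {0..1} \<times> (W \<union> A)"
    by (simp add: eventually_at_filter)
  ultimately show "\<forall>\<^sub>F x in ?F. dist (homotopy (fst x) (snd x)) (homotopy t z) < e"
  proof eventually_elim
    case (elim x)
    then show ?case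
      using d[of "snd x" 0 "fst x"] z by (cases "snd x \<in> A") (auto simp: homotopy_fixed \<sigma>_0)
  qed
qed

theorem continuous_on_homotopy: "continuous_on ({0..1} \<times> (W \<union> A)) (\<lambda>(t, u). homotopy t u)"
  unfolding continuous_on_def
proof
  fix x assume x: "x \<in> {0..1::real} \<times> (W \<union> A)"
  obtain t u where tu: "x = (t, u)"
    by (rule prod.exhaust)
  consider "u \<in> A" | "u \<in> W" "t = 1" | "u \<in> W" "0 \<le> t" "t < 1"
    using x tu by fastforce
  then show "((\<lambda>(t, u). homotopy t u) \<longlongrightarrow> (case x of (t, u) \<Rightarrow> homotopy t u))
      (at x within {0..1} \<times> (W \<union> A))"
    unfolding tu case_prod_unfold fst_conv snd_conv
    using tendsto_homotopy_fixed tendsto_homotopy_endpoint tendsto_homotopy_interior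
    by cases auto
qed

end

section \<open>A continuous minorant of the Cerami weight\<close>

definition cerami_weight :: "('a::real_normed_vector \<Rightarrow> real) \<Rightarrow> 'a \<Rightarrow> real" where
  "cerami_weight \<phi> u = (1 + norm u) * mnorm \<phi> u"

text \<open>The Cerami weight is only lower semicontinuous. The term \<open>\<bar>\<phi> y - \<phi> u\<bar>\<close> keeps
  near-minimisers \<open>y\<close> at bounded levels, so that the Cerami condition survives the
  regularisation.\<close>

definition cerami_minorant :: "('a::real_normed_vector \<Rightarrow> real) \<Rightarrow> 'a \<Rightarrow> real" where
  "cerami_minorant \<phi> u = (INF y. cerami_weight \<phi> y + dist y u + \<bar>\<phi> y - \<phi> u\<bar>)"

text \<open>Half the minorant leaves room for a direction of strictly faster descent.\<close>

definition descent_speed :: "('a::real_normed_vector \<Rightarrow> real) \<Rightarrow> 'a \<Rightarrow> real" where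
  "descent_speed \<phi> u = cerami_minorant \<phi> u / (2 * (1 + norm u))"

lemma cerami_convergent_subsequence:
  assumes lip: "locally_lipschitz \<phi>" and cer: "cerami \<phi>"
    and bounded: "bounded (range (\<lambda>n. \<phi> (y n)))" and weight: "(\<lambda>n. cerami_weight \<phi> (y n)) \<longlonglongrightarrow> 0"
  obtains r z where "strict_mono (r :: nat \<Rightarrow> nat)" "(y \<circ> r) \<longlonglongrightarrow> z" "z \<in> crit \<phi>"
proof -
  obtain r z where r: "strict_mono (r :: nat \<Rightarrow> nat)" "(y \<circ> r) \<longlonglongrightarrow> z"
    using cer bounded weight unfolding cerami_def convergent_def cerami_weight_def by blast
  have "(\<lambda>n. mnorm \<phi> ((y \<circ> r) n)) \<longlonglongrightarrow> 0"
  proof (rule tendsto_sandwich[OF _ _ tendsto_const])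
    show "(\<lambda>n. cerami_weight \<phi> ((y \<circ> r) n)) \<longlonglongrightarrow> 0"
      using LIMSEQ_subseq_LIMSEQ[OF weight r(1)] by (simp add: o_def)
    show "\<forall>\<^sub>F n in sequentially. mnorm \<phi> ((y \<circ> r) n) \<le> cerami_weight \<phi> ((y \<circ> r) n)"
      using mnorm_nonneg[OF lip] by (simp add: cerami_weight_def distrib_right)
  qed (use mnorm_nonneg[OF lip] in auto)
  with r that show thesis
    using mem_crit_of_mnorm_tendsto_0[OF lip] by blast
qed

context
  fixes \<phi> :: "'a::real_normed_vector \<Rightarrow> real"
  assumes lip: "locally_lipschitz \<phi>"
begin

lemma cerami_weight_nonneg: "0 \<le> cerami_weight \<phi> u"
  using mnorm_nonneg[OF lip] by (simp add: cerami_weight_def add_nonneg_nonneg)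

lemma bdd_below_cerami_minorant:
  "bdd_below (range (\<lambda>y. cerami_weight \<phi> y + dist y u + \<bar>\<phi> y - \<phi> u\<bar>))"
  by (rule bdd_belowI2[of _ 0]) (simp add: cerami_weight_nonneg add_nonneg_nonneg)

lemma cerami_minorant_le: "cerami_minorant \<phi> u \<le> cerami_weight \<phi> y + dist y u + \<bar>\<phi> y - \<phi> u\<bar>"
  unfolding cerami_minorant_def by (rule cINF_lower[OF bdd_below_cerami_minorant]) simp

lemma cerami_minorant_le_weight: "cerami_minorant \<phi> u \<le> cerami_weight \<phi> u"
  using cerami_minorant_le[of u u] by simp

lemma cerami_minorant_nonneg: "0 \<le> cerami_minorant \<phi> u"
  unfolding cerami_minorant_def
  by (rule cINF_greatest) (simp_all add: cerami_weight_nonneg add_nonneg_nonneg)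

lemma cerami_minorant_lessE:
  assumes "cerami_minorant \<phi> u < c"
  obtains y where "cerami_weight \<phi> y < c" "dist y u < c" "\<bar>\<phi> y - \<phi> u\<bar> < c"
proof -
  obtain y where "cerami_weight \<phi> y + dist y u + \<bar>\<phi> y - \<phi> u\<bar> < c"
    using assms cINF_less_iff[OF _ bdd_below_cerami_minorant] by (auto simp: cerami_minorant_def)
  then show thesis
    using that[of y] cerami_weight_nonneg[of y] zero_le_dist[of y u] abs_ge_zero[of "\<phi> y - \<phi> u"]
    by linarith
qed

lemma cerami_minorant_diff_le:
  "\<bar>cerami_minorant \<phi> w - cerami_minorant \<phi> u\<bar> \<le> dist w u + \<bar>\<phi> w - \<phi> u\<bar>"
proof -
  have "cerami_minorant \<phi> u - (dist u w + \<bar>\<phi> u - \<phi> w\<bar>) \<le> cerami_minorant \<phi> w" for u w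
    unfolding cerami_minorant_def[of \<phi> w]
  proof (rule cINF_greatest)
    show "cerami_minorant \<phi> u - (dist u w + \<bar>\<phi> u - \<phi> w\<bar>) \<le>
        cerami_weight \<phi> y + dist y w + \<bar>\<phi> y - \<phi> w\<bar>" for y
      using cerami_minorant_le[of u y] dist_triangle[of y u w] by (simp add: dist_commute)
  qed simp
  from this[of u w] this[of w u] show ?thesis
    by (simp add: dist_commute abs_minus_commute abs_le_iff)
qed

lemma continuous_on_cerami_minorant: "continuous_on A (cerami_minorant \<phi>)"
proof (intro continuous_at_imp_continuous_on ballI)
  fix u
  have "((\<lambda>w. dist w u + \<bar>\<phi> w - \<phi> u\<bar>) \<longlongrightarrow> dist u u + \<bar>\<phi> u - \<phi> u\<bar>) (at u)"
    using locally_lipschitz_isCont[OF lip, of u] by (intro tendsto_intros) (simp add: isCont_def)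
  then have "((\<lambda>w. dist w u + \<bar>\<phi> w - \<phi> u\<bar>) \<longlongrightarrow> 0) (at u)" by simp
  with always_eventually have "((\<lambda>w. cerami_minorant \<phi> w - cerami_minorant \<phi> u) \<longlongrightarrow> 0) (at u)"
    by (rule Lim_null_comparison) (simp add: cerami_minorant_diff_le)
  then show "isCont (cerami_minorant \<phi>) u"
    unfolding isCont_def by (rule Lim_null[THEN iffD2])
qed

lemma cerami_minorant_convergent_subsequence:
  assumes cer: "cerami \<phi>" and minorant: "(\<lambda>n. cerami_minorant \<phi> (w n)) \<longlonglongrightarrow> 0"
    and bounded: "bounded (range (\<lambda>n. \<phi> (w n)))"
  obtains r z where "strict_mono (r :: nat \<Rightarrow> nat)" "(w \<circ> r) \<longlonglongrightarrow> z" "z \<in> crit \<phi>"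
proof -
  define c where "c n = cerami_minorant \<phi> (w n) + inverse (real (Suc n))" for n
  have "\<exists>y. cerami_weight \<phi> y < c n \<and> dist y (w n) < c n \<and> \<bar>\<phi> y - \<phi> (w n)\<bar> < c n" for n
    by (rule cerami_minorant_lessE[of "w n" "c n"]) (auto simp: c_def)
  then obtain y where y: "\<And>n. cerami_weight \<phi> (y n) < c n" "\<And>n. dist (y n) (w n) < c n"
      "\<And>n. \<bar>\<phi> (y n) - \<phi> (w n)\<bar> < c n"
    by metis
  have c: "c \<longlonglongrightarrow> 0"
    using tendsto_add[OF minorant LIMSEQ_inverse_real_of_nat] by (simp add: c_def[abs_def])
  have null: "f \<longlonglongrightarrow> 0" if "\<And>n. 0 \<le> f n" "\<And>n. f n < c n" for f :: "nat \<Rightarrow> real"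
    by (rule tendsto_sandwich[OF _ _ tendsto_const c])
      (use that in \<open>auto intro!: always_eventually less_imp_le\<close>)
  have "(\<lambda>n. \<phi> (y n) - \<phi> (w n)) \<longlonglongrightarrow> 0"
    using null[OF abs_ge_zero y(3)] by (simp add: tendsto_rabs_zero_iff)
  from bounded_plus_comp[OF bounded convergent_imp_bounded[OF this]]
  have "bounded (range (\<lambda>n. \<phi> (y n)))" by simp
  then obtain r z where r: "strict_mono (r :: nat \<Rightarrow> nat)" "(y \<circ> r) \<longlonglongrightarrow> z" "z \<in> crit \<phi>"
    using cerami_convergent_subsequence[OF lip cer, of y] null[OF cerami_weight_nonneg y(1)] by auto
  have "(\<lambda>n. dist ((y \<circ> r) n) ((w \<circ> r) n)) \<longlonglongrightarrow> 0"
    using LIMSEQ_subseq_LIMSEQ[OF null[OF zero_le_dist y(2)] r(1)] by (simp add: o_def)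
  then have "(\<lambda>n. (y \<circ> r) n - (w \<circ> r) n) \<longlonglongrightarrow> 0"
    by (simp add: dist_norm tendsto_norm_zero_iff)
  with r(2) have "(w \<circ> r) \<longlonglongrightarrow> z"
    by (rule Lim_transform2)
  with r(1,3) that show thesis by blast
qed

lemma cerami_minorant_bounded_below:
  assumes cer: "cerami \<phi>" and "closed C" and disjoint: "C \<inter> crit_at \<phi> (ereal c) = {}"
  obtains \<delta> where "0 < \<delta>" "\<And>w. w \<in> C \<Longrightarrow> \<bar>\<phi> w - c\<bar> < \<delta> \<Longrightarrow> \<delta> \<le> cerami_minorant \<phi> w"
proof (rule ccontr)
  assume no_bound: "\<not> thesis"
  have "\<exists>w\<in>C. \<bar>\<phi> w - c\<bar> < inverse (real (Suc n)) \<and>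
      cerami_minorant \<phi> w < inverse (real (Suc n))" for n
    using no_bound that[of "inverse (real (Suc n))"] by (force simp: not_less)
  then obtain w where w: "\<And>n. w n \<in> C" "\<And>n. \<bar>\<phi> (w n) - c\<bar> < inverse (real (Suc n))"
      "\<And>n. cerami_minorant \<phi> (w n) < inverse (real (Suc n))"
    by metis
  have null: "f \<longlonglongrightarrow> 0" if "\<And>n. 0 \<le> f n" "\<And>n. f n < inverse (real (Suc n))" for f :: "nat \<Rightarrow> real"
    by (rule tendsto_sandwich[OF _ _ tendsto_const LIMSEQ_inverse_real_of_nat])
      (use that in \<open>auto intro!: always_eventually less_imp_le\<close>)
  have level: "(\<lambda>n. \<phi> (w n)) \<longlonglongrightarrow> c"
    using null[OF abs_ge_zero w(2)] by (simp add: tendsto_rabs_zero_iff flip: Lim_null)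
  obtain r z where r: "strict_mono (r :: nat \<Rightarrow> nat)" "(w \<circ> r) \<longlonglongrightarrow> z" "z \<in> crit \<phi>"
    using cerami_minorant_convergent_subsequence[OF cer null[OF cerami_minorant_nonneg w(3)]]
      convergent_imp_bounded[OF level] by metis
  have "z \<in> C"
    using closed_sequentially[OF \<open>closed C\<close> _ r(2)] w(1) by simp
  moreover have "\<phi> z = c"
  proof (rule LIMSEQ_unique)
    show "(\<lambda>n. \<phi> ((w \<circ> r) n)) \<longlonglongrightarrow> \<phi> z"
      using locally_lipschitz_isCont[OF lip] r(2) by (rule isCont_tendsto_compose)
    show "(\<lambda>n. \<phi> ((w \<circ> r) n)) \<longlonglongrightarrow> c"
      using LIMSEQ_subseq_LIMSEQ[OF level r(1)] by (simp add: o_def)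
  qed
  ultimately show False
    using disjoint r(3) by (auto simp: crit_at_def)
qed

lemma cerami_minorant_pos:
  assumes cer: "cerami \<phi>" and "u \<notin> crit \<phi>"
  shows "0 < cerami_minorant \<phi> u"
  using cerami_minorant_bounded_below[OF cer closed_singleton, of u "\<phi> u"] assms(2)
  by (force simp: crit_at_def)

lemma descent_speed_ge:
  assumes "0 \<le> \<delta>" "\<delta> \<le> cerami_minorant \<phi> u" "1 + norm u \<le> R"
  shows "\<delta> / (2 * R) \<le> descent_speed \<phi> u"
  unfolding descent_speed_def using assms
  by (intro frac_le) (auto simp: add_pos_nonneg)

lemma descent_speed_nonneg: "0 \<le> descent_speed \<phi> u"
  using cerami_minorant_nonneg[of u] by (simp add: descent_speed_def add_nonneg_nonneg)

lemma continuous_on_descent_speed: "continuous_on A (descent_speed \<phi>)"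
proof -
  have "2 * (1 + norm u) \<noteq> 0" for u :: 'a
    by (simp add: add_pos_nonneg less_imp_neq[symmetric])
  then show ?thesis
    unfolding descent_speed_def[abs_def]
    by (intro continuous_intros continuous_on_cerami_minorant) blast
qed

lemma descent_speed_pos:
  assumes "cerami \<phi>" "u \<notin> crit \<phi>"
  shows "0 < descent_speed \<phi> u"
  using cerami_minorant_pos[OF assms] by (simp add: descent_speed_def add_pos_nonneg)

lemma descent_speed_less_mnorm:
  assumes "cerami \<phi>" "u \<notin> crit \<phi>"
  shows "descent_speed \<phi> u < mnorm \<phi> u"
proof -
  have "0 < 1 + norm u"
    by (simp add: add_pos_nonneg)
  then have "2 * descent_speed \<phi> u = cerami_minorant \<phi> u / (1 + norm u)"
    by (simp add: descent_speed_def divide_simps)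
  also have "\<dots> \<le> mnorm \<phi> u"
    using cerami_minorant_le_weight[of u] \<open>0 < 1 + norm u\<close>
    by (simp add: cerami_weight_def divide_le_eq mult.commute)
  finally show ?thesis
    using descent_speed_pos[OF assms] by simp
qed

lemma descent_speed_bounded_below:
  assumes cer: "cerami \<phi>" and "closed C" "bounded C" and disjoint: "C \<inter> crit_at \<phi> (ereal c) = {}"
  obtains \<delta> where "0 < \<delta>" "\<And>w. w \<in> C \<Longrightarrow> \<bar>\<phi> w - c\<bar> < \<delta> \<Longrightarrow> \<delta> \<le> descent_speed \<phi> w"
proof -
  obtain \<delta> where \<delta>: "0 < \<delta>" "\<And>w. w \<in> C \<Longrightarrow> \<bar>\<phi> w - c\<bar> < \<delta> \<Longrightarrow> \<delta> \<le> cerami_minorant \<phi> w"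
    using cerami_minorant_bounded_below[OF cer \<open>closed C\<close> disjoint] by metis
  obtain R where R: "0 < R" "\<And>w. w \<in> C \<Longrightarrow> norm w \<le> R"
    using \<open>bounded C\<close> unfolding bounded_pos by blast
  have "\<delta> / (2 * (1 + R)) \<le> descent_speed \<phi> w" if "w \<in> C" "\<bar>\<phi> w - c\<bar> < \<delta>" for w
    using \<delta> R(2) that by (intro descent_speed_ge) auto
  with \<delta>(1) R(1) show thesis
    by (intro that[of "min \<delta> (\<delta> / (2 * (1 + R)))"]) (auto simp: min_le_iff_disj)
qed

end

section \<open>Crossings and drop estimates\<close>

lemma last_crossing:
  fixes f :: "real \<Rightarrow> real"
  assumes cont: "continuous_on {s..t} f" and "s \<le> t" "f s \<le> p" "p \<le> f t"
  obtains r where "r \<in> {s..t}" "f r = p" "\<And>x. x \<in> {r..t} \<Longrightarrow> p \<le> f x"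
proof -
  let ?B = "{x \<in> {s..t}. f x \<le> p}"
  have "compact ({s..t} \<inter> ?B)"
    using cont by (intro compact_Int_closed compact_Icc continuous_on_closed_Collect_le
        continuous_on_const closed_atLeastAtMost)
  then have "compact ?B"
    by (simp add: Int_absorb1 subset_iff)
  moreover have "s \<in> ?B"
    using assms by simp
  ultimately obtain r where r: "r \<in> ?B" "\<And>x. x \<in> ?B \<Longrightarrow> x \<le> r"
    using compact_attains_sup[of ?B] by blast
  have "continuous_on {r..t} f"
    using cont r(1) by (auto intro: continuous_on_subset)
  then obtain x where "r \<le> x" "x \<le> t" "f x = p"
    using IVT'[of f r p t] r(1) \<open>p \<le> f t\<close> by auto
  with r have "f r = p"
    by (metis (mono_tags, lifting) antisym atLeastAtMost_iff mem_Collect_eq order_refl order_trans)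
  moreover have "p \<le> f x" if "x \<in> {r..t}" for x
    using r(2)[of x] r(1) that \<open>f r = p\<close> by (cases "x = r") force+
  ultimately show thesis
    using r(1) that by blast
qed

lemma first_crossing:
  fixes f :: "real \<Rightarrow> real"
  assumes cont: "continuous_on {s..t} f" and "s \<le> t" "f s \<le> q" "q \<le> f t"
  obtains r where "r \<in> {s..t}" "f r = q" "\<And>x. x \<in> {s..r} \<Longrightarrow> f x \<le> q"
proof -
  have "continuous_on {- t..- s} (\<lambda>x. - f (- x))"
    by (intro continuous_intros continuous_on_compose2[OF cont]) auto
  then obtain r where r: "r \<in> {- t..- s}" "- f (- r) = - q" "\<And>x. x \<in> {r..- s} \<Longrightarrow> - q \<le> - f (- x)"
    using last_crossing[of "- t" "- s" "\<lambda>x. - f (- x)" "- q"] assms by auto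
  have "f x \<le> q" if "x \<in> {s..- r}" for x
    using r(3)[of "- x"] that by simp
  with r(1,2) show thesis
    by (intro that[of "- r"]) auto
qed

lemma band_crossing:
  fixes f :: "real \<Rightarrow> real"
  assumes cont: "continuous_on {s..t} f" and "s \<le> t" "f s \<le> p" "p \<le> q" "q \<le> f t"
  obtains s' t' where "s \<le> s'" "s' \<le> t'" "t' \<le> t" "f s' = p" "f t' = q"
    "\<And>r. r \<in> {s'..t'} \<Longrightarrow> p \<le> f r \<and> f r \<le> q"
proof -
  obtain t' where t': "t' \<in> {s..t}" "f t' = q" "\<And>x. x \<in> {s..t'} \<Longrightarrow> f x \<le> q"
    using first_crossing[OF cont, of q] assms by auto
  have "continuous_on {s..t'} f"
    using cont t'(1) by (auto intro: continuous_on_subset)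
  then obtain s' where "s' \<in> {s..t'}" "f s' = p" "\<And>x. x \<in> {s'..t'} \<Longrightarrow> p \<le> f x"
    using last_crossing[of s t' f p] assms t'(1,2) by auto
  with t' show thesis
    by (intro that[of s' t']) auto
qed

lemma drop_ge_of_unit_intervals:
  fixes G :: "real \<Rightarrow> real \<Rightarrow> real" and f :: "real \<Rightarrow> real"
  assumes triangle: "\<And>r s t. G r t \<le> G r s + G s t"
    and local: "\<And>r t. \<lbrakk>p \<le> r; r \<le> t; t \<le> q; t \<le> of_int \<lfloor>r\<rfloor> + 1\<rbrakk> \<Longrightarrow> G r t \<le> f r - f t"
    and "p \<le> q"
  shows "G p q \<le> f p - f q"
  using local \<open>p \<le> q\<close>
proof (induction "nat (\<lfloor>q\<rfloor> - \<lfloor>p\<rfloor>)" arbitrary: p rule: less_induct)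
  case less
  define m where "m = of_int \<lfloor>p\<rfloor> + (1 :: real)"
  show ?case
  proof (cases "q \<le> m")
    case True
    then show ?thesis
      using less.prems by (simp add: m_def)
  next
    case False
    have "p \<le> m" "\<lfloor>m\<rfloor> = \<lfloor>p\<rfloor> + 1"
      unfolding m_def by linarith+
    then have "nat (\<lfloor>q\<rfloor> - \<lfloor>m\<rfloor>) < nat (\<lfloor>q\<rfloor> - \<lfloor>p\<rfloor>)"
      using False floor_mono[of m q] by linarith
    then have "G m q \<le> f m - f q"
      using less.prems(1) False \<open>p \<le> m\<close> by (intro less.hyps) auto
    moreover have "G p m \<le> f p - f m"
      using False \<open>p \<le> m\<close> by (intro less.prems(1)) (auto simp: m_def)
    ultimately show ?thesis
      using triangle[of p q m] by linarith
  qed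
qed

lemma Cauchy_of_dist_le_drop:
  fixes X :: "nat \<Rightarrow> 'a::metric_space"
  assumes "0 < \<kappa>" and drop: "\<And>m n. m \<le> n \<Longrightarrow> \<kappa> * dist (X m) (X n) \<le> f m - f n"
    and bounded: "\<And>n. c \<le> f n"
  shows "Cauchy X"
proof (rule metric_CauchyI)
  have "decseq f"
  proof (rule decseq_SucI)
    fix n
    have "0 \<le> \<kappa> * dist (X n) (X (Suc n))"
      using \<open>0 < \<kappa>\<close> by simp
    then show "f (Suc n) \<le> f n"
      using drop[of n "Suc n"] by simp
  qed
  then have "Cauchy f"
    using decseq_convergent[of f c] bounded LIMSEQ_imp_Cauchy by metis
  fix e :: real assume "0 < e"
  then obtain M where M: "\<And>m n. m \<ge> M \<Longrightarrow> n \<ge> M \<Longrightarrow> dist (f m) (f n) < \<kappa> * e"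
    using metric_CauchyD[OF \<open>Cauchy f\<close>, of "\<kappa> * e"] \<open>0 < \<kappa>\<close> by auto
  have "dist (X m) (X n) < e" if "m \<ge> M" "n \<ge> M" for m n
  proof -
    have "\<kappa> * dist (X m) (X n) \<le> dist (f m) (f n)"
      using drop[of m n] drop[of n m] by (cases "m \<le> n") (auto simp: dist_real_def dist_commute)
    also have "\<dots> < \<kappa> * e"
      using M that by blast
    finally show ?thesis
      using \<open>0 < \<kappa>\<close> by simp
  qed
  then show "\<exists>M. \<forall>m\<ge>M. \<forall>n\<ge>M. dist (X m) (X n) < e"
    by blast
qed

lemma ln_norm_diff_le:
  fixes x y :: "'a::real_normed_vector"
  shows "ln (1 + norm y) - ln (1 + norm x) \<le> dist x y / (1 + norm x)"
proof -
  have "0 < 1 + norm x" "0 < 1 + norm y"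
    by (simp_all add: add_pos_nonneg)
  then have "ln (1 + norm y) - ln (1 + norm x) \<le> ((1 + norm y) - (1 + norm x)) / (1 + norm x)"
    by (intro ln_diff_le)
  also have "\<dots> \<le> dist x y / (1 + norm x)"
    using \<open>0 < 1 + norm x\<close> norm_triangle_ineq2[of y x]
    by (intro divide_right_mono) (auto simp: dist_norm norm_minus_commute)
  finally show ?thesis .
qed

section \<open>The descending flow\<close>

definition noncritical_above :: "('a::real_normed_vector \<Rightarrow> real) \<Rightarrow> real \<Rightarrow> 'a set" where
  "noncritical_above \<phi> a = {u. a < \<phi> u} - crit \<phi>"

lemma open_noncritical_above:
  assumes "locally_lipschitz \<phi>"
  shows "open (noncritical_above \<phi> a)"
  unfolding noncritical_above_def by (intro open_Diff open_superlevel closed_crit assms)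

text \<open>The flow is not a semigroup: \<open>flow s u\<close> is a polygon in \<open>s\<close> with vertices at the
  integers, and the descent estimate holds on each of its edges.\<close>

locale cerami_descent = self_homotopy "noncritical_above \<phi> a" S
  for \<phi> :: "'a::banach \<Rightarrow> real" and a :: real and S +
  fixes b :: ereal
  assumes lip: "locally_lipschitz \<phi>" and cer: "cerami \<phi>"
    and finite_crit: "finite (crit_at \<phi> (ereal a))"
    and no_crit_between: "\<And>c. a < c \<Longrightarrow> ereal c < b \<Longrightarrow> crit_at \<phi> (ereal c) = {}"
    and step_decreasing: "\<And>u. u \<in> noncritical_above \<phi> a \<Longrightarrow> \<phi> (S 1 u) < \<phi> u"
    and step_drop: "\<And>u r s. \<lbrakk>u \<in> noncritical_above \<phi> a; 0 \<le> r; r \<le> s; s \<le> 1\<rbrakk> \<Longrightarrow>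
      descent_speed \<phi> (S r u) * dist (S r u) (S s u) \<le> \<phi> (S r u) - \<phi> (S s u)"
begin

abbreviation noncritical :: "'a set" where
  "noncritical \<equiv> noncritical_above \<phi> a"

lemma flow_level_gt: "u \<in> noncritical \<Longrightarrow> a < \<phi> (flow s u)"
  using flow_in[of u s] by (simp add: noncritical_above_def)

lemma continuous_on_orbit: "u \<in> noncritical \<Longrightarrow> continuous_on {0..} (\<lambda>s. flow s u)"
  using continuous_on_compose2[OF continuous_on_flow, of "{0..}" "\<lambda>s. (s, u)"]
  by (auto simp: image_subset_iff continuous_on_Pair continuous_on_id)

lemma edge_drop:
  assumes u: "u \<in> noncritical" and "0 \<le> r" "r \<le> t" "t \<le> of_int \<lfloor>r\<rfloor> + 1"
  shows "descent_speed \<phi> (flow r u) * dist (flow r u) (flow t u) \<le> \<phi> (flow r u) - \<phi> (flow t u)"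
proof -
  define n where "n = nat \<lfloor>r\<rfloor>"
  have n: "of_int \<lfloor>r\<rfloor> = real n"
    using \<open>0 \<le> r\<close> by (simp add: n_def)
  have edge: "flow x u = S (x - real n) ((S 1 ^^ n) u)" if "r \<le> x" "x \<le> t" for x
    using flow_edge[OF u, of "x - real n" n] that assms n of_int_floor_le[of r] by simp
  show ?thesis
    using step_drop[of "(S 1 ^^ n) u" "r - real n" "t - real n"] vertex_in[OF u, of n] assms n
      of_int_floor_le[of r] by (simp add: edge)
qed

lemma flow_drop_ge:
  assumes u: "u \<in> noncritical" and st: "0 \<le> s" "s \<le> t" and "0 \<le> \<delta>"
    and speed: "\<And>r. r \<in> {s..t} \<Longrightarrow> \<delta> \<le> descent_speed \<phi> (flow r u)"
  shows "\<delta> * dist (flow s u) (flow t u) \<le> \<phi> (flow s u) - \<phi> (flow t u)"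
proof (rule drop_ge_of_unit_intervals[OF _ _ st(2)])
  show "\<delta> * dist (flow p u) (flow q u)
      \<le> \<delta> * dist (flow p u) (flow r u) + \<delta> * dist (flow r u) (flow q u)" for p q r
    using \<open>0 \<le> \<delta>\<close> by (simp add: dist_triangle mult_left_mono flip: distrib_left)
next
  fix p q assume pq: "s \<le> p" "p \<le> q" "q \<le> t" "q \<le> of_int \<lfloor>p\<rfloor> + 1"
  then have "\<delta> * dist (flow p u) (flow q u)
      \<le> descent_speed \<phi> (flow p u) * dist (flow p u) (flow q u)"
    using speed by (intro mult_right_mono) auto
  also have "\<dots> \<le> \<phi> (flow p u) - \<phi> (flow q u)"
    using pq st by (intro edge_drop[OF u]) auto
  finally show "\<delta> * dist (flow p u) (flow q u) \<le> \<phi> (flow p u) - \<phi> (flow q u)" .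
qed

lemma flow_ln_drop_ge:
  assumes u: "u \<in> noncritical" and st: "0 \<le> s" "s \<le> t" and "0 \<le> \<delta>"
    and minorant: "\<And>r. r \<in> {s..t} \<Longrightarrow> \<delta> \<le> cerami_minorant \<phi> (flow r u)"
  shows "\<delta> / 2 * (ln (1 + norm (flow t u)) - ln (1 + norm (flow s u)))
    \<le> \<phi> (flow s u) - \<phi> (flow t u)"
proof (rule drop_ge_of_unit_intervals[OF _ _ st(2)])
  fix p q assume pq: "s \<le> p" "p \<le> q" "q \<le> t" "q \<le> of_int \<lfloor>p\<rfloor> + 1"
  have "\<delta> / 2 * (ln (1 + norm (flow q u)) - ln (1 + norm (flow p u)))
      \<le> \<delta> / 2 * (dist (flow p u) (flow q u) / (1 + norm (flow p u)))"
    using \<open>0 \<le> \<delta>\<close> by (intro mult_left_mono ln_norm_diff_le) simp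
  also have "\<dots> = \<delta> / (2 * (1 + norm (flow p u))) * dist (flow p u) (flow q u)"
    by simp
  also have "\<dots> \<le> descent_speed \<phi> (flow p u) * dist (flow p u) (flow q u)"
    using minorant pq \<open>0 \<le> \<delta>\<close> by (intro mult_right_mono descent_speed_ge[OF lip]) auto
  also have "\<dots> \<le> \<phi> (flow p u) - \<phi> (flow q u)"
    using pq st by (intro edge_drop[OF u]) auto
  finally show "\<delta> / 2 * (ln (1 + norm (flow q u)) - ln (1 + norm (flow p u)))
      \<le> \<phi> (flow p u) - \<phi> (flow q u)" .
qed (simp add: algebra_simps)

lemma flow_antimono: "u \<in> noncritical \<Longrightarrow> 0 \<le> s \<Longrightarrow> s \<le> t \<Longrightarrow> \<phi> (flow t u) \<le> \<phi> (flow s u)"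
  using flow_drop_ge[of u s t 0] descent_speed_nonneg[OF lip] by simp

lemma flow_le_start: "u \<in> noncritical \<Longrightarrow> 0 \<le> s \<Longrightarrow> \<phi> (flow s u) \<le> \<phi> u"
  using flow_antimono[of u 0 s] flow_0 by simp

lemma annulus_crossing_drop:
  assumes u: "u \<in> noncritical" and st: "0 \<le> s" "s \<le> t" and "0 \<le> \<delta>" "p \<le> q"
    and dist: "dist (flow s u) z \<le> p" "q \<le> dist (flow t u) z"
    and speed: "\<And>w. \<lbrakk>w \<in> noncritical; p \<le> dist w z; dist w z \<le> q; \<phi> w \<le> \<phi> (flow s u)\<rbrakk>
      \<Longrightarrow> \<delta> \<le> descent_speed \<phi> w"
  shows "\<delta> * (q - p) \<le> \<phi> (flow s u) - \<phi> (flow t u)"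
proof -
  have "continuous_on {s..t} (\<lambda>r. dist (flow r u) z)"
    using st(1) by (intro continuous_intros continuous_on_subset[OF continuous_on_orbit[OF u]]) auto
  then obtain s' t' where st': "s \<le> s'" "s' \<le> t'" "t' \<le> t"
      and dist': "dist (flow s' u) z = p" "dist (flow t' u) z = q"
      and annulus: "\<And>r. r \<in> {s'..t'} \<Longrightarrow> p \<le> dist (flow r u) z \<and> dist (flow r u) z \<le> q"
    using band_crossing[of s t "\<lambda>r. dist (flow r u) z" p q] st \<open>p \<le> q\<close> dist by metis
  have "q - p \<le> dist (flow s' u) (flow t' u)"
    using dist_triangle[of "flow t' u" z "flow s' u"] dist' by (simp add: dist_commute)
  then have "\<delta> * (q - p) \<le> \<delta> * dist (flow s' u) (flow t' u)"
    using \<open>0 \<le> \<delta>\<close> by (rule mult_left_mono)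
  also have "\<dots> \<le> \<phi> (flow s' u) - \<phi> (flow t' u)"
    using st st' annulus \<open>0 \<le> \<delta>\<close> flow_antimono[OF u] flow_in[OF u]
    by (intro flow_drop_ge[OF u] speed) auto
  also have "\<dots> \<le> \<phi> (flow s u) - \<phi> (flow t u)"
    using st st' flow_antimono[OF u] by (intro diff_mono) auto
  finally show ?thesis .
qed

text \<open>Near the level \<open>a\<close> there is not enough of \<open>\<phi>\<close> left to cross an annulus around \<open>z\<close>
  that avoids the other critical points of level \<open>a\<close>.\<close>

lemma flow_stable:
  assumes z: "\<phi> z = a" and "0 < e"
  obtains d where "0 < d"
    "\<And>u s t. \<lbrakk>u \<in> noncritical; 0 \<le> s; dist (flow s u) z < d; s \<le> t\<rbrakk> \<Longrightarrow> dist (flow t u) z < e"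
proof -
  obtain r where "0 < r" and r: "\<And>y. y \<in> crit_at \<phi> (ereal a) \<Longrightarrow> y \<noteq> z \<Longrightarrow> r \<le> dist z y"
    using finite_set_avoid[OF finite_crit, of z] by blast
  define q where "q = min e (r / 2)"
  have q: "0 < q" "q \<le> e" "q < r"
    using \<open>0 < e\<close> \<open>0 < r\<close> by (auto simp: q_def)
  define C where "C = cball z q - ball z (q / 2)"
  have "closed C" "bounded C"
    by (auto simp: C_def bounded_subset[OF bounded_cball])
  moreover have "C \<inter> crit_at \<phi> (ereal a) = {}"
    using r q by (force simp: C_def)
  ultimately obtain \<delta> where "0 < \<delta>" and \<delta>: "\<And>w. w \<in> C \<Longrightarrow> \<bar>\<phi> w - a\<bar> < \<delta> \<Longrightarrow> \<delta> \<le> descent_speed \<phi> w"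
    using descent_speed_bounded_below[OF lip cer] by metis
  define m where "m = min \<delta> (\<delta> * (q - q / 2))"
  have "0 < m"
    using \<open>0 < \<delta>\<close> q(1) by (simp add: m_def)
  then obtain d where "0 < d" and d: "\<And>w. dist w z < d \<Longrightarrow> \<bar>\<phi> w - a\<bar> < m"
    using locally_lipschitz_isCont[OF lip, of z] z
    unfolding continuous_at_eps_delta dist_real_def by metis
  have "dist (flow t u) z < e"
    if u: "u \<in> noncritical" and s: "0 \<le> s" "dist (flow s u) z < min d (q / 2)" "s \<le> t" for u s t
  proof (rule ccontr)
    assume "\<not> dist (flow t u) z < e"
    have level: "\<phi> (flow s u) < a + m"
      using d[of "flow s u"] s(2) by (simp add: abs_less_iff)
    have "\<delta> * (q - q / 2) \<le> \<phi> (flow s u) - \<phi> (flow t u)"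
    proof (rule annulus_crossing_drop[OF u s(1,3)])
      fix w assume "w \<in> noncritical" "q / 2 \<le> dist w z" "dist w z \<le> q" "\<phi> w \<le> \<phi> (flow s u)"
      then show "\<delta> \<le> descent_speed \<phi> w"
        using level by (intro \<delta>) (auto simp: C_def dist_commute m_def noncritical_above_def)
    qed (use \<open>0 < \<delta>\<close> q s(2) \<open>\<not> dist (flow t u) z < e\<close> in auto)
    then show False
      using level flow_level_gt[OF u, of t] by (simp add: m_def)
  qed
  with \<open>0 < d\<close> q(1) that show thesis
    by (metis half_gt_zero min_less_iff_conj)
qed

lemma tendsto_of_cluster_point:
  assumes u: "u \<in> noncritical" and s: "\<And>n::nat. real n \<le> s n"
    and lim: "(\<lambda>n. flow (s n) u) \<longlonglongrightarrow> z" and z: "\<phi> z = a"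
  shows "((\<lambda>s. flow s u) \<longlongrightarrow> z) at_top"
proof (rule tendstoI)
  fix e :: real assume "0 < e"
  then obtain d where "0 < d"
    and d: "\<And>s t. \<lbrakk>0 \<le> s; dist (flow s u) z < d; s \<le> t\<rbrakk> \<Longrightarrow> dist (flow t u) z < e"
    using flow_stable[OF z] u by metis
  obtain n where "dist (flow (s n) u) z < d"
    using lim \<open>0 < d\<close> unfolding lim_sequentially by blast
  moreover have "0 \<le> s n"
    using s[of n] by linarith
  ultimately show "\<forall>\<^sub>F t in at_top. dist (flow t u) z < e"
    using d unfolding eventually_at_top_linorder by blast
qed

lemma cluster_point_level:
  assumes u: "u \<in> noncritical" "ereal (\<phi> u) \<le> b" and s: "\<And>n::nat. real n \<le> s n"
    and lim: "(\<lambda>n. flow (s n) u) \<longlonglongrightarrow> z"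
  shows "\<phi> z = a \<or> z \<in> noncritical"
proof -
  have level: "(\<lambda>n. \<phi> (flow (s n) u)) \<longlonglongrightarrow> \<phi> z"
    using locally_lipschitz_isCont[OF lip] lim by (rule isCont_tendsto_compose)
  then have "a \<le> \<phi> z"
    using flow_level_gt[OF u(1)] by (intro LIMSEQ_le_const[of _ "\<phi> z"]) (auto intro: less_imp_le)
  have "\<phi> z \<le> \<phi> (flow 1 u)"
  proof (rule LIMSEQ_le_const2[OF level], intro exI[of _ 1] allI impI)
    fix n :: nat assume "1 \<le> n"
    then show "\<phi> (flow (s n) u) \<le> \<phi> (flow 1 u)"
      using s[of n] by (intro flow_antimono[OF u(1)]) auto
  qed
  also have "\<dots> < \<phi> u"
    using step_decreasing u(1) flow_of_nat[OF u(1), of 1] by simp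
  finally have "ereal (\<phi> z) < b"
    using u(2) by (metis less_ereal.simps(1) order_less_le_trans)
  with \<open>a \<le> \<phi> z\<close> show ?thesis
    using no_crit_between[of "\<phi> z"] by (force simp: crit_at_def noncritical_above_def)
qed

text \<open>A limit of the vertices is fixed by the Euler step, which strictly decreases \<open>\<phi>\<close> at
  noncritical points.\<close>

lemma vertex_limit_not_noncritical:
  assumes u: "u \<in> noncritical" and lim: "(\<lambda>n. flow (real n) u) \<longlonglongrightarrow> z"
  shows "z \<notin> noncritical"
proof
  assume z: "z \<in> noncritical"
  have "continuous_on noncritical (S 1)"
    using continuous_on_vertex[of 1] by simp
  then have "(\<lambda>n. S 1 (flow (real n) u)) \<longlonglongrightarrow> S 1 z"
    using lim z by (rule continuous_on_tendsto_compose) (simp add: flow_in[OF u])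
  moreover have "(\<lambda>n. S 1 (flow (real n) u)) \<longlonglongrightarrow> z"
    using LIMSEQ_Suc[OF lim] flow_of_nat[OF u] by (simp del: of_nat_Suc)
  ultimately have "S 1 z = z"
    by (rule LIMSEQ_unique)
  then show False
    using step_decreasing[of z] z by simp
qed

lemma orbit_bounded:
  assumes u: "u \<in> noncritical" and "0 < \<delta>" "0 \<le> s"
    and minorant: "\<And>r. s \<le> r \<Longrightarrow> \<delta> \<le> cerami_minorant \<phi> (flow r u)"
  obtains R where "0 < R" "\<And>r. s \<le> r \<Longrightarrow> 1 + norm (flow r u) \<le> R"
proof -
  define R where "R = exp (ln (1 + norm (flow s u)) + 2 / \<delta> * (\<phi> (flow s u) - a))"
  have "1 + norm (flow r u) \<le> R" if "s \<le> r" for r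
  proof -
    have "\<delta> / 2 * (ln (1 + norm (flow r u)) - ln (1 + norm (flow s u)))
        \<le> \<phi> (flow s u) - \<phi> (flow r u)"
      using \<open>0 < \<delta>\<close> \<open>0 \<le> s\<close> that minorant by (intro flow_ln_drop_ge[OF u]) auto
    also have "\<dots> \<le> \<phi> (flow s u) - a"
      using flow_level_gt[OF u, of r] by simp
    finally have "ln (1 + norm (flow r u)) \<le> ln (1 + norm (flow s u)) + 2 / \<delta> * (\<phi> (flow s u) - a)"
      using \<open>0 < \<delta>\<close> by (simp add: field_simps)
    then show ?thesis
      unfolding R_def by (metis add_pos_nonneg exp_le_cancel_iff exp_ln norm_ge_zero zero_less_one)
  qed
  then show thesis
    by (intro that[of R]) (auto simp: R_def)
qed

lemma vertices_convergent:
  assumes u: "u \<in> noncritical" and "0 < \<delta>" "0 \<le> s"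
    and minorant: "\<And>r. s \<le> r \<Longrightarrow> \<delta> \<le> cerami_minorant \<phi> (flow r u)"
  obtains z where "(\<lambda>n. flow (real n) u) \<longlonglongrightarrow> z"
proof -
  obtain R where R: "0 < R" "\<And>r. s \<le> r \<Longrightarrow> 1 + norm (flow r u) \<le> R"
    using orbit_bounded[OF assms] by metis
  have speed: "\<delta> / (2 * R) \<le> descent_speed \<phi> (flow r u)" if "s \<le> r" for r
    using \<open>0 < \<delta>\<close> minorant R(2) that by (intro descent_speed_ge[OF lip]) auto
  obtain M where "s \<le> real M"
    using real_arch_simple by blast
  have "Cauchy (\<lambda>n. flow (real (n + M)) u)"
  proof (rule Cauchy_of_dist_le_drop)
    show "0 < \<delta> / (2 * R)"
      using \<open>0 < \<delta>\<close> R(1) by simp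
    show "\<delta> / (2 * R) * dist (flow (real (m + M)) u) (flow (real (n + M)) u)
        \<le> \<phi> (flow (real (m + M)) u) - \<phi> (flow (real (n + M)) u)" if "m \<le> n" for m n
      using that \<open>0 < \<delta>\<close> R(1) \<open>s \<le> real M\<close> by (intro flow_drop_ge[OF u] speed) auto
    show "a \<le> \<phi> (flow (real (n + M)) u)" for n
      using flow_level_gt[OF u] by (rule less_imp_le)
  qed
  then obtain z where "(\<lambda>n. flow (real (n + M)) u) \<longlonglongrightarrow> z"
    using Cauchy_convergent convergent_def by blast
  then have "(\<lambda>n. flow (real n) u) \<longlonglongrightarrow> z"
    by (rule LIMSEQ_offset)
  then show thesis by (rule that)
qed

lemma orbit_cluster_point:
  assumes u: "u \<in> noncritical"
  obtains s z where "\<And>n::nat. real n \<le> s n" "(\<lambda>n. flow (s n) u) \<longlonglongrightarrow> z" "z \<notin> noncritical"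
proof (cases "\<exists>\<delta>>0. \<exists>s\<ge>0. \<forall>r\<ge>s. \<delta> \<le> cerami_minorant \<phi> (flow r u)")
  case True
  then obtain z where "(\<lambda>n. flow (real n) u) \<longlonglongrightarrow> z"
    using vertices_convergent[OF u] by blast
  with vertex_limit_not_noncritical[OF u] show thesis
    by (intro that[of real]) auto
next
  case False
  then have "\<exists>s\<ge>real n. cerami_minorant \<phi> (flow s u) < inverse (real (Suc n))" for n
    by (metis inverse_positive_iff_positive not_le of_nat_0_le_iff of_nat_0_less_iff zero_less_Suc)
  then obtain s where s: "\<And>n. real n \<le> s n"
      and small: "\<And>n. cerami_minorant \<phi> (flow (s n) u) < inverse (real (Suc n))"
    by metis
  have "0 \<le> s n" for n
    using s[of n] by linarith
  then have "range (\<lambda>n. \<phi> (flow (s n) u)) \<subseteq> {a..\<phi> u}"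
    using flow_le_start[OF u] less_imp_le[OF flow_level_gt[OF u]] by auto
  then have bounded: "bounded (range (\<lambda>n. \<phi> (flow (s n) u)))"
    by (rule bounded_subset[OF bounded_closed_interval])
  have "(\<lambda>n. cerami_minorant \<phi> (flow (s n) u)) \<longlonglongrightarrow> 0"
    by (rule tendsto_sandwich[OF _ _ tendsto_const LIMSEQ_inverse_real_of_nat])
      (use small cerami_minorant_nonneg[OF lip] in \<open>auto intro!: always_eventually less_imp_le\<close>)
  then obtain r z where r: "strict_mono (r :: nat \<Rightarrow> nat)" "(\<lambda>n. flow (s (r n)) u) \<longlonglongrightarrow> z" "z \<in> crit \<phi>"
    using cerami_minorant_convergent_subsequence[OF lip cer _ bounded] by (auto simp: o_def)
  have "real n \<le> s (r n)" for n
    using s[of "r n"] seq_suble[OF r(1), of n] by linarith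
  with r(2,3) show thesis
    by (intro that[of "s \<circ> r"]) (auto simp: o_def noncritical_above_def)
qed

lemma flow_attracted:
  assumes u: "u \<in> noncritical" "ereal (\<phi> u) \<le> b"
  obtains z where "\<phi> z = a" "((\<lambda>s. flow s u) \<longlongrightarrow> z) at_top"
proof -
  obtain s z where s: "\<And>n::nat. real n \<le> s n" "(\<lambda>n. flow (s n) u) \<longlonglongrightarrow> z" "z \<notin> noncritical"
    using orbit_cluster_point[OF u(1)] by metis
  then have "\<phi> z = a"
    using cluster_point_level[OF u s(1,2)] by blast
  with tendsto_of_cluster_point[OF u(1) s(1,2)] that show thesis
    by blast
qed

lemma flow_away_from_lower_level:
  assumes "\<phi> z < a"
  obtains d where "0 < d" "\<And>u s. u \<in> noncritical \<Longrightarrow> d \<le> dist (flow s u) z"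
proof -
  have "isCont \<phi> z"
    by (rule locally_lipschitz_isCont[OF lip])
  then obtain d where "0 < d" and d: "\<And>w. dist w z < d \<Longrightarrow> \<bar>\<phi> w - \<phi> z\<bar> < a - \<phi> z"
    using assms unfolding continuous_at_eps_delta dist_real_def by (metis diff_gt_0_iff_gt)
  have "d \<le> dist (flow s u) z" if "u \<in> noncritical" for u s
    using d[of "flow s u"] flow_level_gt[OF that, of s] by (force simp: abs_less_iff)
  with \<open>0 < d\<close> show thesis
    by (rule that)
qed

abbreviation strip :: "'a set" where
  "strip \<equiv> noncritical \<inter> sublevel \<phi> b"

sublocale attracting_flow flow strip "sublevel \<phi> (ereal a)"
proof
  show "strip \<inter> sublevel \<phi> (ereal a) = {}"
    by (auto simp: sublevel_def noncritical_above_def)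
  have "strip = (strip \<union> sublevel \<phi> (ereal a)) \<inter> {u. a < \<phi> u}"
    by (auto simp: sublevel_def noncritical_above_def)
  then show "openin (top_of_set (strip \<union> sublevel \<phi> (ereal a))) strip"
    using open_superlevel[OF lip] unfolding openin_open by blast
  show "continuous_on ({0..} \<times> strip) (\<lambda>(s, u). flow s u)"
    by (rule continuous_on_subset[OF continuous_on_flow]) auto
  show "flow 0 u = u" if "u \<in> strip" for u
    using that by (intro flow_0) simp
  show "\<exists>z\<in>sublevel \<phi> (ereal a). ((\<lambda>s. flow s u) \<longlongrightarrow> z) at_top" if u: "u \<in> strip" for u
  proof -
    obtain z where "\<phi> z = a" "((\<lambda>s. flow s u) \<longlongrightarrow> z) at_top"
      using flow_attracted[of u] u by (auto simp: sublevel_def)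
    then show ?thesis
      by (intro bexI[of _ z]) (auto simp: sublevel_def)
  qed
next
  fix z and e :: real assume z: "z \<in> sublevel \<phi> (ereal a)" and "0 < e"
  obtain d where "0 < d"
    "\<And>u s t. \<lbrakk>u \<in> noncritical; 0 \<le> s; dist (flow s u) z < d; s \<le> t\<rbrakk> \<Longrightarrow> dist (flow t u) z < e"
  proof (cases "\<phi> z = a")
    case True
    then show thesis
      using flow_stable[OF _ \<open>0 < e\<close>] that by metis
  next
    case False
    with z have "\<phi> z < a"
      by (simp add: sublevel_def)
    then show thesis
      using flow_away_from_lower_level that by (metis not_less)
  qed
  then show "\<exists>d>0. \<forall>u\<in>strip. \<forall>s\<ge>0. dist (flow s u) z < d \<longrightarrow> (\<forall>t\<ge>s. dist (flow t u) z < e)"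
    by blast
qed

lemma flow_in_strip:
  assumes "u \<in> strip" "0 \<le> s"
  shows "flow s u \<in> strip"
proof -
  have "ereal (\<phi> (flow s u)) \<le> ereal (\<phi> u)"
    using assms flow_le_start[of u s] by simp
  also have "\<dots> \<le> b"
    using assms(1) by (simp add: sublevel_def)
  finally show ?thesis
    using assms(1) flow_in[of u s] by (simp add: sublevel_def)
qed

lemma homotopy_descends:
  assumes t: "t \<in> {0..1}" and u: "u \<in> strip \<union> sublevel \<phi> (ereal a)"
  shows "homotopy t u \<in> strip \<union> sublevel \<phi> (ereal a)" "\<phi> (homotopy t u) \<le> \<phi> u"
proof -
  consider "u \<in> sublevel \<phi> (ereal a)" | "u \<in> strip" "t = 1" | "u \<in> strip" "0 \<le> t / (1 - t)" "t < 1"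
    using t u by fastforce
  then have "homotopy t u \<in> strip \<union> sublevel \<phi> (ereal a) \<and> \<phi> (homotopy t u) \<le> \<phi> u"
  proof cases
    case 1
    then show ?thesis by (simp add: homotopy_fixed)
  next
    case 2
    then show ?thesis
      using homotopy_1_in[of u] by (auto simp: noncritical_above_def sublevel_def)
  next
    case 3
    then show ?thesis
      using flow_in_strip[of u "t / (1 - t)"] flow_le_start[of u "t / (1 - t)"]
      by (simp add: homotopy_interior)
  qed
  then show "homotopy t u \<in> strip \<union> sublevel \<phi> (ereal a)" "\<phi> (homotopy t u) \<le> \<phi> u"
    by blast+
qed

end

lemma cerami_descent_exists:
  fixes \<phi> :: "'a::banach \<Rightarrow> real"
  assumes lip: "locally_lipschitz \<phi>" and cer: "cerami \<phi>"
    and "finite (crit_at \<phi> (ereal a))"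
    and "\<And>c. a < c \<Longrightarrow> ereal c < b \<Longrightarrow> crit_at \<phi> (ereal c) = {}"
  obtains S where "cerami_descent \<phi> a S b"
proof -
  have pos: "0 < descent_speed \<phi> u" and less: "descent_speed \<phi> u < mnorm \<phi> u"
    if "u \<in> noncritical_above \<phi> a" for u
    using that descent_speed_pos[OF lip cer] descent_speed_less_mnorm[OF lip cer]
    by (simp_all add: noncritical_above_def)
  obtain S where "self_homotopy (noncritical_above \<phi> a) S"
    "\<And>u. u \<in> noncritical_above \<phi> a \<Longrightarrow> \<phi> (S 1 u) < \<phi> u"
    "\<And>u r s. \<lbrakk>u \<in> noncritical_above \<phi> a; 0 \<le> r; r \<le> s; s \<le> 1\<rbrakk> \<Longrightarrow>
      descent_speed \<phi> (S r u) * dist (S r u) (S s u) \<le> \<phi> (S r u) - \<phi> (S s u)"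
    using euler_step[OF lip open_noncritical_above[OF lip] continuous_on_descent_speed[OF lip] pos less]
    by blast
  then have "cerami_descent \<phi> a S b"
    using assms by (simp add: cerami_descent_def cerami_descent_axioms_def)
  then show thesis by (rule that)
qed

lemma sublevel_diff_crit_at_eq:
  assumes "ereal a < b" and "\<And>c. a < c \<Longrightarrow> ereal c < b \<Longrightarrow> crit_at \<phi> (ereal c) = {}"
  shows "sublevel \<phi> b - crit_at \<phi> b = (noncritical_above \<phi> a \<inter> sublevel \<phi> b) \<union> sublevel \<phi> (ereal a)"
proof -
  have "ereal (\<phi> u) < b" if "\<phi> u \<le> a" for u
    using that assms(1) by (metis ereal_less_eq(3) order_le_less_trans)
  moreover have "ereal (\<phi> u) = b" if "a < \<phi> u" "ereal (\<phi> u) \<le> b" "u \<in> crit \<phi>" for u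
    using assms(2)[of "\<phi> u"] that by (force simp: crit_at_def order_le_less)
  ultimately show ?thesis
    by (fastforce simp: sublevel_def crit_at_def noncritical_above_def)
qed

theorem theorem2p6:
  fixes \<phi> :: "'a::banach \<Rightarrow> real" and a :: real and b :: ereal
  assumes "reflexive_space TYPE('a)"
    and "locally_lipschitz \<phi>"
    and "cerami \<phi>"
    and "ereal a < b"
    and "finite (crit_at \<phi> (ereal a))"
    and "\<forall>c::real. ereal a < ereal c \<and> ereal c < b \<longrightarrow> crit_at \<phi> (ereal c) = {}"
  shows "\<exists>h :: real \<Rightarrow> 'a \<Rightarrow> 'a.
     continuous_on ({0..1} \<times> (sublevel \<phi> b - crit_at \<phi> b)) (\<lambda>(t, u). h t u) \<and>
     (\<forall>t\<in>{0..1}. \<forall>u\<in>sublevel \<phi> b - crit_at \<phi> b. h t u \<in> sublevel \<phi> b - crit_at \<phi> b) \<and>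
     (\<forall>u\<in>sublevel \<phi> b - crit_at \<phi> b. h 0 u = u \<and> h 1 u \<in> sublevel \<phi> (ereal a)) \<and>
     (\<forall>t\<in>{0..1}. \<forall>u\<in>sublevel \<phi> (ereal a). h t u = u) \<and>
     (\<forall>t\<in>{0..1}. \<forall>u\<in>sublevel \<phi> b - crit_at \<phi> b. \<phi> (h t u) \<le> \<phi> u)"
proof -
  have no_crit: "crit_at \<phi> (ereal c) = {}" if "a < c" "ereal c < b" for c
    using assms(6) that by simp
  obtain S where "cerami_descent \<phi> a S b"
    using cerami_descent_exists[OF assms(2,3,5) no_crit] .
  then interpret cerami_descent \<phi> a S b .
  have domain: "sublevel \<phi> b - crit_at \<phi> b = strip \<union> sublevel \<phi> (ereal a)"
    using assms(4) no_crit by (rule sublevel_diff_crit_at_eq)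
  show ?thesis
    unfolding domain
  proof (intro exI[of _ homotopy] conjI ballI)
    show "continuous_on ({0..1} \<times> (strip \<union> sublevel \<phi> (ereal a))) (\<lambda>(t, u). homotopy t u)"
      by (rule continuous_on_homotopy)
  qed (use homotopy_0 homotopy_1_in homotopy_fixed homotopy_descends in blast)+
qed

end
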